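(* For a stable graph $G$ put $$z(G)=\frac{(-1)^{|V(G)|}2^{w(G)}}{|\mathrm{Aut}(G)|}\sum_{C\in\mathscr C(G)}\frac{(-1)^{\mathfrak m(C)}\varphi(\Gamma_C)}{(\mathfrak m(C)+w(G))!}.$$ If $G$ is a disjoint union of connected subgraphs $G=\bigcup_{i=1}^k G_i$, then $$z(G)=\frac{\prod_{j=1}^k z(G_j)}{|Sym(G_1,\dots,G_k)|},$$ where $Sym(G_1,\dots,G_k)$ is the permutation group of the connected subgraphs, i.e. the group of permutations $\sigma$ of $\{1,\dots,k\}$ such that $G_{\sigma(i)}\cong G_i$ for all $i$.
   Context: Graphs. A graph is a finite directed graph $G=(V,E)$ with multiple edges and loops allowed; $\deg^+(v)$ and $\deg^-(v)$ are the numbers of outward and inward edges at $v$ (a loop contributes one to each). The weight is $w(G)=|E|-|V|$. $G$ is stable if $\deg^+(v)\ge2$ and $\deg^-(v)\ge2$ for every vertex $v$. "Connected" means (weakly) connected as an undirected graph, and nonempty. $\mathrm{Aut}(G)$ is the group of automorphisms of the multi-digraph, i.e. pairs of bijections of $V$ and of $E$ compatible with sources and targets (so permutations of parallel edges and of loops are counted). Pointed graphs. A pointed graph $\Gamma=(V\cup\{\bullet\},E)$ is a multi-digraph with a distinguished vertex $\bullet$; the other vertices are called ordinary. A digraph is strongly connected if there is a directed path from each vertex to every other vertex. The invariant $\varphi(\Gamma)$ of a pointed graph is defined recursively: (i) if $\Gamma$ is not strongly connected, $\varphi(\Gamma)=0$; (ii) if $\Gamma$ consists only of $\bullet$ with $l\ge0$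 loops, $\varphi(\Gamma)=l!$; (iii) if $\Gamma$ is strongly connected and there is an ordinary vertex $v$ with $\deg^+(v)=\deg^-(v)=1$, then $\varphi(\Gamma)=\varphi(\Gamma/\{v\})$, where $\Gamma/\{v\}$ is obtained by smoothing out $v$ (removing $v$ and replacing its inward edge $uv$ and outward edge $vu'$ by one edge $uu'$); (iv) for any other strongly connected $\Gamma$, $\varphi(\Gamma)=\sum_{e\in E(\Gamma)}\varphi(\Gamma-\{e\})$, where $\Gamma-\{e\}$ is $\Gamma$ with the edge $e$ deleted and its endpoints kept. Edge-cuttings. $\mathscr C(G)$ is the set of all $2^{|E(G)|}$ edge-cuttings of $G$; an edge-cutting $C$ is a choice of a subset of the edges of $G$, each of which is cut, producing two loose ends (one outward at its source and one inward at its target). $\mathfrak m(C)$ is the number of edges cut, and $\Gamma_C$ is the pointed graph obtained from $G$ by connecting all loose ends to a new vertex $\bullet$ (so a cut edge $uv$ is replaced by the two edges $u\bullet$ and $\bullet v$). *)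

theory Defs
  imports
    Complex_Main
    "HOL-Combinatorics.Permutations"
    "Graph_Theory.Digraph_Component"
    "Graph_Theory.Digraph_Isomorphism"
begin

definition weight :: "('a, 'b) pre_digraph \<Rightarrow> int" where
  "weight G = int (card (arcs G)) - int (card (verts G))"

definition stable :: "('a, 'b) pre_digraph \<Rightarrow> bool" where
  "stable G \<longleftrightarrow> (\<forall>v\<in>verts G. 2 \<le> out_degree G v \<and> 2 \<le> in_degree G v)"

text \<open>Automorphisms are pairs of bijections of the vertices and of the arcs. Using
  permutations of the carrier types that fix everything outside \<open>G\<close> makes each
  such pair occur exactly once, so that cardinalities are those of the group.\<close>

definition Aut :: "('a, 'b) pre_digraph \<Rightarrow> (('a \<Rightarrow> 'a) \<times> ('b \<Rightarrow> 'b)) set" where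
  "Aut G = {(f, g). f permutes verts G \<and> g permutes arcs G \<and>
     (\<forall>e\<in>arcs G. tail G (g e) = f (tail G e) \<and> head G (g e) = f (head G e))}"

definition Sym :: "nat \<Rightarrow> (nat \<Rightarrow> ('a, 'b) pre_digraph) \<Rightarrow> (nat \<Rightarrow> nat) set" where
  "Sym k H = {\<sigma>. \<sigma> permutes {1..k} \<and> (\<forall>i\<in>{1..k}. digraph_iso (H (\<sigma> i)) (H i))}"

text \<open>A pointed graph is a multi-digraph \<open>\<Gamma>\<close> together with a distinguished vertex \<open>p\<close>.\<close>

definition smoothable :: "'a \<Rightarrow> ('a, 'b) pre_digraph \<Rightarrow> 'a \<Rightarrow> bool" where
  "smoothable p \<Gamma> v \<longleftrightarrow>
     v \<in> verts \<Gamma> \<and> v \<noteq> p \<and> out_degree \<Gamma> v = 1 \<and> in_degree \<Gamma> v = 1"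

text \<open>The arc replacing the inward arc \<open>uv\<close> and the outward arc \<open>vu'\<close> reuses the name of
  the inward arc. Only meaningful when \<open>v\<close> has exactly one inward and one outward
  arc and these are distinct, i.e. not a loop; the latter is automatic when \<open>v\<close> is an ordinary
  vertex of a strongly connected pointed graph.\<close>

definition smooth :: "('a, 'b) pre_digraph \<Rightarrow> 'a \<Rightarrow> ('a, 'b) pre_digraph" where
  "smooth \<Gamma> v =
     (let e = (THE e. e \<in> in_arcs \<Gamma> v); f = (THE f. f \<in> out_arcs \<Gamma> v) in
      \<lparr> verts = verts \<Gamma> - {v}, arcs = arcs \<Gamma> - {f},
        tail = tail \<Gamma>, head = (head \<Gamma>)(e := head \<Gamma> f) \<rparr>)"

text \<open>The vertex to be smoothed out is selected by \<open>SOME\<close>: smoothings at different vertices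
  commute up to the names of the arcs, so the value does not depend on the choice.
  The guard \<^const>\<open>fin_digraph\<close> only serves to make the function total.\<close>

function phi :: "'a \<Rightarrow> ('a, 'b) pre_digraph \<Rightarrow> nat" where
  "phi p \<Gamma> =
     (if \<not> fin_digraph \<Gamma> then 0
      else if \<not> strongly_connected \<Gamma> then 0
      else if verts \<Gamma> = {p} then fact (card (arcs \<Gamma>))
      else if \<exists>v. smoothable p \<Gamma> v then phi p (smooth \<Gamma> (SOME v. smoothable p \<Gamma> v))
      else (\<Sum>e\<in>arcs \<Gamma>. phi p (pre_digraph.del_arc \<Gamma> e)))"
  by pat_completeness auto

termination
proof (relation "measure (\<lambda>(p, \<Gamma>). card (verts \<Gamma>) + card (arcs \<Gamma>))")
  show "wf (measure (\<lambda>(p :: 'a, \<Gamma> :: ('a, 'b) pre_digraph). card (verts \<Gamma>) + card (arcs \<Gamma>)))"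
    by simp
next
  fix p :: 'a and \<Gamma> :: "('a, 'b) pre_digraph"
  assume "\<not> \<not> fin_digraph \<Gamma>" "\<exists>v. smoothable p \<Gamma> v"
  then interpret fin_digraph \<Gamma> by simp
  let ?v = "SOME v. smoothable p \<Gamma> v"
  have "?v \<in> verts \<Gamma>"
    using someI_ex[OF \<open>\<exists>v. smoothable p \<Gamma> v\<close>] by (simp add: smoothable_def)
  then have "card (verts \<Gamma> - {?v}) < card (verts \<Gamma>)"
    by (intro psubset_card_mono) auto
  moreover have "card (arcs \<Gamma> - {THE f. f \<in> out_arcs \<Gamma> ?v}) \<le> card (arcs \<Gamma>)"
    by (intro card_mono) auto
  ultimately show "((p, smooth \<Gamma> ?v), p, \<Gamma>)
      \<in> measure (\<lambda>(p, \<Gamma>). card (verts \<Gamma>) + card (arcs \<Gamma>))"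
    by (simp add: smooth_def Let_def)
next
  fix p :: 'a and \<Gamma> :: "('a, 'b) pre_digraph" and e
  assume "\<not> \<not> fin_digraph \<Gamma>" and e: "e \<in> arcs \<Gamma>"
  then interpret fin_digraph \<Gamma> by simp
  have "card (arcs \<Gamma> - {e}) < card (arcs \<Gamma>)"
    using e by (intro psubset_card_mono) auto
  then show "((p, pre_digraph.del_arc \<Gamma> e), p, \<Gamma>)
      \<in> measure (\<lambda>(p, \<Gamma>). card (verts \<Gamma>) + card (arcs \<Gamma>))"
    by simp
qed

declare phi.simps [simp del]

text \<open>An edge-cutting of \<open>G\<close> is the set \<open>C\<close> of the arcs that are cut. In \<open>cut_graph G C\<close> the vertex
  \<open>\<bullet>\<close> is \<^const>\<open>None\<close>; a cut arc \<open>e\<close> from \<open>u\<close> to \<open>v\<close> gives \<open>Out_End e\<close> from \<open>u\<close> to \<open>\<bullet>\<close> and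
  \<open>In_End e\<close> from \<open>\<bullet>\<close> to \<open>v\<close>.\<close>

datatype 'b cut_arc = Whole 'b | Out_End 'b | In_End 'b

definition cut_graph :: "('a, 'b) pre_digraph \<Rightarrow> 'b set \<Rightarrow> ('a option, 'b cut_arc) pre_digraph" where
  "cut_graph G C =
     \<lparr> verts = insert None (Some ` verts G),
       arcs = Whole ` (arcs G - C) \<union> Out_End ` C \<union> In_End ` C,
       tail = (\<lambda>a. case a of Whole e \<Rightarrow> Some (tail G e) | Out_End e \<Rightarrow> Some (tail G e) | In_End e \<Rightarrow> None),
       head = (\<lambda>a. case a of Whole e \<Rightarrow> Some (head G e) | Out_End e \<Rightarrow> None | In_End e \<Rightarrow> Some (head G e)) \<rparr>"

text \<open>For stable \<open>G\<close> the weight is nonnegative, so \<^const>\<open>nat\<close> does not truncate.\<close>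

definition z :: "('a, 'b) pre_digraph \<Rightarrow> real" where
  "z G = (-1) ^ card (verts G) * 2 powi weight G / real (card (Aut G)) *
     (\<Sum>C\<in>Pow (arcs G). (-1) ^ card C * real (phi None (cut_graph G C)) /
        fact (nat (int (card C) + weight G)))"

end

theory Submission
  imports Defs
begin

text \<open>
Apart from the factors \<open>(-1) ^ |V|\<close> and \<open>2 powi w\<close>, which are visibly multiplicative, \<open>z G\<close> is the
quotient of a sum over edge-cuttings by the order of the automorphism group. The sum is multiplicative
under disjoint unions, and the automorphism group accounts for the factor \<open>|Sym|\<close>.

An edge-cutting of a disjoint union consists of edge-cuttings of the parts, and all loose ends run to
one new vertex; so the cut graph is the one-point union of the cut graphs of the parts. The summand
\<open>phi \<Gamma> / (m + w)!\<close> is \<open>psi \<Gamma> = phi \<Gamma> / r!\<close>, where \<open>r = |E| + 1 - |V|\<close> is the cycle rank of the cut graph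
\<open>\<Gamma>\<close>. The point is that \<open>psi\<close> is multiplicative under one-point unions (\<open>psi_wedge\<close>). Indeed \<open>psi\<close> is
1 on bouquets of loops, smoothing does not change it, and
\<open>r * psi \<Gamma> = (\<Sum>e. psi (\<Gamma> - e))\<close> if there is nothing to smooth (\<open>psi_del_arc\<close>). Since \<open>r\<close> is additive, the
product of the values on two summands satisfies the recursion for their union.

One obstacle remains: the recursion for the union smooths an arbitrary vertex, while that for the summand
containing this vertex may smooth a different one. Hence the value of \<open>phi\<close> must not depend on the
choice (\<open>phi_smooth\<close>). This holds because smoothings at two vertices commute (\<open>smooth_commute\<close>).

An automorphism of \<open>G\<close> permutes the connected components by some \<open>\<sigma>\<close> in \<open>Sym\<close>, and the
automorphisms over a given \<open>\<sigma>\<close> are the families of isomorphisms from the component \<open>H i\<close> to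
\<open>H (\<sigma> i)\<close>. There are as many of these as families of automorphisms of the \<open>H i\<close>, so
\<open>|Aut G| = |Sym| * (\<Prod>i. |Aut (H i)|)\<close> (\<open>card_Aut\<close>).
\<close>

section \<open>Independence of the choice of the smoothed vertex\<close>

text \<open>Two records describe the same graph as soon as their \<open>tail\<close> and \<open>head\<close> functions agree on the
arcs. Smoothing leaves behind a stale value of \<open>head\<close> at the arc that it removes, so two smoothings
performed in either order agree only in this sense and not as records.\<close>

definition same_graph :: "('a, 'b) pre_digraph \<Rightarrow> ('a, 'b) pre_digraph \<Rightarrow> bool" where
  "same_graph \<Gamma> \<Delta> \<longleftrightarrow> verts \<Gamma> = verts \<Delta> \<and> arcs \<Gamma> = arcs \<Delta> \<and>
     (\<forall>a\<in>arcs \<Gamma>. tail \<Gamma> a = tail \<Delta> a \<and> head \<Gamma> a = head \<Delta> a)"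

lemma same_graph_arcs_at:
  assumes "same_graph \<Gamma> \<Delta>"
  shows "in_arcs \<Gamma> v = in_arcs \<Delta> v" "out_arcs \<Gamma> v = out_arcs \<Delta> v"
  using assms by (auto simp: same_graph_def in_arcs_def out_arcs_def)

lemma same_graph_fin_digraph:
  assumes "same_graph \<Gamma> \<Delta>"
  shows "fin_digraph \<Gamma> \<longleftrightarrow> fin_digraph \<Delta>"
  using assms
  unfolding same_graph_def fin_digraph_def fin_digraph_axioms_def wf_digraph_def by auto

lemma same_graph_strongly_connected:
  assumes "same_graph \<Gamma> \<Delta>"
  shows "strongly_connected \<Gamma> \<longleftrightarrow> strongly_connected \<Delta>"
proof -
  have "arcs_ends \<Gamma> = arcs_ends \<Delta>" "verts \<Gamma> = verts \<Delta>"
    using assms by (auto simp: same_graph_def arcs_ends_conv)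
  then show ?thesis by (simp add: strongly_connected_def reachable_def)
qed

lemma same_graph_smoothable:
  assumes "same_graph \<Gamma> \<Delta>"
  shows "smoothable p \<Gamma> = smoothable p \<Delta>"
  using assms by (auto simp: fun_eq_iff smoothable_def in_degree_def out_degree_def
      same_graph_arcs_at[OF assms] same_graph_def)

lemma same_graph_del_arc:
  assumes "same_graph \<Gamma> \<Delta>"
  shows "same_graph (pre_digraph.del_arc \<Gamma> e) (pre_digraph.del_arc \<Delta> e)"
  using assms by (auto simp: same_graph_def pre_digraph.del_arc_simps)

lemma smooth_eq:
  assumes "in_arcs \<Gamma> v = {e}" "out_arcs \<Gamma> v = {f}"
  shows "smooth \<Gamma> v = \<lparr> verts = verts \<Gamma> - {v}, arcs = arcs \<Gamma> - {f},
           tail = tail \<Gamma>, head = (head \<Gamma>)(e := head \<Gamma> f) \<rparr>"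
  using assms by (simp add: smooth_def)

lemma smoothable_arcs:
  assumes "smoothable p \<Gamma> v"
  obtains e f where "in_arcs \<Gamma> v = {e}" "out_arcs \<Gamma> v = {f}"
  using assms unfolding smoothable_def in_degree_def out_degree_def
  by (meson card_1_singletonE)

lemma same_graph_smooth:
  assumes "same_graph \<Gamma> \<Delta>" "smoothable p \<Gamma> v"
  shows "same_graph (smooth \<Gamma> v) (smooth \<Delta> v)"
proof -
  obtain e f where ef: "in_arcs \<Gamma> v = {e}" "out_arcs \<Gamma> v = {f}"
    using assms(2) by (rule smoothable_arcs)
  then have "in_arcs \<Delta> v = {e}" "out_arcs \<Delta> v = {f}" "f \<in> arcs \<Gamma>"
    using same_graph_arcs_at[OF assms(1)] by (auto simp: set_eq_iff)
  with ef assms(1) show ?thesis by (simp add: smooth_eq same_graph_def)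
qed

text \<open>No confluence argument enters here: the two graphs have the same smoothable vertices, so \<open>SOME\<close>
picks the same one on both sides and the two recursions run in parallel.\<close>

lemma phi_same_graph:
  assumes "same_graph \<Gamma> \<Delta>"
  shows "phi p \<Gamma> = phi p \<Delta>"
  using assms
proof (induction p \<Gamma> arbitrary: \<Delta> rule: phi.induct)
  case (1 p \<Gamma>)
  note eqs = same_graph_fin_digraph[OF 1(3)] same_graph_strongly_connected[OF 1(3)] same_graph_smoothable[OF 1(3), of p]
  have va: "verts \<Gamma> = verts \<Delta>" "arcs \<Gamma> = arcs \<Delta>" using 1(3) by (auto simp: same_graph_def)
  consider "\<not> fin_digraph \<Gamma> \<or> \<not> strongly_connected \<Gamma> \<or> verts \<Gamma> = {p}"
    | (smooth) "fin_digraph \<Gamma>" "strongly_connected \<Gamma>" "verts \<Gamma> \<noteq> {p}" "\<exists>v. smoothable p \<Gamma> v"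
    | (del) "fin_digraph \<Gamma>" "strongly_connected \<Gamma>" "verts \<Gamma> \<noteq> {p}" "\<not> (\<exists>v. smoothable p \<Gamma> v)"
    by blast
  then show ?case
  proof cases
    case 1
    then show ?thesis using eqs va by (auto simp: phi.simps[of p \<Gamma>] phi.simps[of p \<Delta>])
  next
    case smooth
    have "phi p (smooth \<Gamma> (SOME v. smoothable p \<Gamma> v)) = phi p (smooth \<Delta> (SOME v. smoothable p \<Gamma> v))"
      using smooth "1.prems" by (intro "1.IH"(1)) (auto intro: same_graph_smooth someI)
    then show ?thesis using smooth eqs va
      unfolding phi.simps[of p \<Gamma>] phi.simps[of p \<Delta>] by simp
  next
    case del
    have "phi p (pre_digraph.del_arc \<Gamma> e) = phi p (pre_digraph.del_arc \<Delta> e)" if "e \<in> arcs \<Gamma>" for e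
      using del "1.prems" that by (intro "1.IH"(2)) (auto intro: same_graph_del_arc)
    then show ?thesis using del eqs va
      unfolding phi.simps[of p \<Gamma>] phi.simps[of p \<Delta>] by auto
  qed
qed

text \<open>At a smoothable vertex \<open>v\<close> of a strongly connected graph the inward arc \<open>e\<close> and the outward arc
\<open>f\<close> are distinct: if they were one loop, then no walk could leave \<open>v\<close> to reach \<open>p\<close>.\<close>

lemma smoothable_strongly_connectedE:
  assumes "fin_digraph \<Gamma>" "strongly_connected \<Gamma>" "p \<in> verts \<Gamma>" "smoothable p \<Gamma> v"
  obtains e f where
    "in_arcs \<Gamma> v = {e}" "out_arcs \<Gamma> v = {f}"
    "e \<in> arcs \<Gamma>" "head \<Gamma> e = v" "tail \<Gamma> e \<noteq> v"
    "f \<in> arcs \<Gamma>" "tail \<Gamma> f = v" "head \<Gamma> f \<noteq> v"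
    "\<forall>a\<in>arcs \<Gamma>. head \<Gamma> a = v \<longleftrightarrow> a = e"
    "\<forall>a\<in>arcs \<Gamma>. tail \<Gamma> a = v \<longleftrightarrow> a = f"
    "smooth \<Gamma> v = \<lparr> verts = verts \<Gamma> - {v}, arcs = arcs \<Gamma> - {f},
        tail = tail \<Gamma>, head = (head \<Gamma>)(e := head \<Gamma> f) \<rparr>"
proof -
  interpret fin_digraph \<Gamma> by fact
  obtain e f where ef: "in_arcs \<Gamma> v = {e}" "out_arcs \<Gamma> v = {f}"
    using assms(4) by (rule smoothable_arcs)
  then have e: "e \<in> arcs \<Gamma>" "head \<Gamma> e = v" and f: "f \<in> arcs \<Gamma>" "tail \<Gamma> f = v"
    by (auto simp: set_eq_iff)
  have uniq: "head \<Gamma> a = v \<longleftrightarrow> a = e" "tail \<Gamma> a = v \<longleftrightarrow> a = f" if "a \<in> arcs \<Gamma>" for a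
    using ef that by (auto simp: set_eq_iff)
  have "e \<noteq> f"
  proof
    assume "e = f"
    have "v \<rightarrow>\<^sup>*\<^bsub>\<Gamma>\<^esub> p" using assms by (auto simp: strongly_connected_def smoothable_def)
    then have "p = v"
    proof (induction rule: reachable_induct)
      case (step x y)
      then obtain a where "a \<in> arcs \<Gamma>" "tail \<Gamma> a = v" "head \<Gamma> a = y" by blast
      then show ?case using uniq \<open>e = f\<close> by auto
    qed auto
    then show False using assms(4) by (simp add: smoothable_def)
  qed
  with e f uniq have "tail \<Gamma> e \<noteq> v" "head \<Gamma> f \<noteq> v" by auto
  with e f uniq ef show thesis by (intro that[of e f] smooth_eq) auto
qed

lemma fin_digraph_smooth:
  assumes "fin_digraph \<Gamma>" "strongly_connected \<Gamma>" "p \<in> verts \<Gamma>" "smoothable p \<Gamma> v"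
  shows "fin_digraph (smooth \<Gamma> v)"
proof -
  interpret fin_digraph \<Gamma> by fact
  from assms obtain e f where ef: "e \<in> arcs \<Gamma>" "head \<Gamma> e = v" "tail \<Gamma> e \<noteq> v"
    "f \<in> arcs \<Gamma>" "tail \<Gamma> f = v" "head \<Gamma> f \<noteq> v"
    "\<forall>a\<in>arcs \<Gamma>. head \<Gamma> a = v \<longleftrightarrow> a = e"
    "\<forall>a\<in>arcs \<Gamma>. tail \<Gamma> a = v \<longleftrightarrow> a = f"
    "smooth \<Gamma> v = \<lparr> verts = verts \<Gamma> - {v}, arcs = arcs \<Gamma> - {f},
        tail = tail \<Gamma>, head = (head \<Gamma>)(e := head \<Gamma> f) \<rparr>"
    by (rule smoothable_strongly_connectedE)
  show ?thesis
    unfolding ef(9) using ef(1-8) by unfold_locales auto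
qed

text \<open>A walk through \<open>v\<close> enters by \<open>e\<close> and leaves by \<open>f\<close>, and the new arc bypasses this detour. In the
induction a walk that currently stops at \<open>v\<close> is matched with one that stops at the tail of \<open>e\<close>,
where it waits to take the bypass.\<close>

lemma strongly_connected_smooth:
  assumes "fin_digraph \<Gamma>" "strongly_connected \<Gamma>" "p \<in> verts \<Gamma>" "smoothable p \<Gamma> v"
  shows "strongly_connected (smooth \<Gamma> v)"
proof -
  interpret fin_digraph \<Gamma> by fact
  from assms obtain e f where ef: "e \<in> arcs \<Gamma>" "head \<Gamma> e = v" "tail \<Gamma> e \<noteq> v"
    "f \<in> arcs \<Gamma>" "tail \<Gamma> f = v" "head \<Gamma> f \<noteq> v"
    and uniq: "\<forall>a\<in>arcs \<Gamma>. head \<Gamma> a = v \<longleftrightarrow> a = e"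
      "\<forall>a\<in>arcs \<Gamma>. tail \<Gamma> a = v \<longleftrightarrow> a = f"
    and eq: "smooth \<Gamma> v = \<lparr> verts = verts \<Gamma> - {v}, arcs = arcs \<Gamma> - {f},
        tail = tail \<Gamma>, head = (head \<Gamma>)(e := head \<Gamma> f) \<rparr>"
    by (rule smoothable_strongly_connectedE)
  let ?S = "smooth \<Gamma> v"
  interpret S: fin_digraph ?S using assms by (rule fin_digraph_smooth)
  have SI: "tail \<Gamma> a \<rightarrow>\<^bsub>?S\<^esub> head ?S a" if "a \<in> arcs \<Gamma>" "a \<noteq> f" for a
    unfolding arcs_ends_conv using that by (auto simp: eq)
  have bypass: "(y \<noteq> v \<longrightarrow> x \<rightarrow>\<^sup>*\<^bsub>?S\<^esub> y) \<and> (y = v \<longrightarrow> x \<rightarrow>\<^sup>*\<^bsub>?S\<^esub> tail \<Gamma> e)"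
    if "x \<rightarrow>\<^sup>*\<^bsub>\<Gamma>\<^esub> y" "x \<noteq> v" for x y
    using that
  proof (induction rule: reachable_induct)
    case base
    then have "x \<in> verts ?S" using \<open>x \<noteq> v\<close> by (simp add: eq)
    then show ?case using base by auto
  next
    case (step y y')
    then obtain a where a: "a \<in> arcs \<Gamma>" "tail \<Gamma> a = y" "head \<Gamma> a = y'" by blast
    show ?case
    proof (cases "y = v")
      case True
      then have "a = f" using a uniq by blast
      have "tail \<Gamma> e \<rightarrow>\<^bsub>?S\<^esub> head \<Gamma> f" using SI[of e] ef by (auto simp: eq)
      moreover have "x \<rightarrow>\<^sup>*\<^bsub>?S\<^esub> tail \<Gamma> e" using step True by blast
      ultimately show ?thesis using \<open>a = f\<close> a ef S.reachable_adj_trans by blast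
    next
      case False
      then have x: "x \<rightarrow>\<^sup>*\<^bsub>?S\<^esub> y" and "a \<noteq> f" using step a uniq ef by auto
      show ?thesis
      proof (cases "y' = v")
        case True
        then show ?thesis using a uniq x by auto
      next
        case False
        then have "y \<rightarrow>\<^bsub>?S\<^esub> y'" using SI[of a] a \<open>a \<noteq> f\<close> ef by (auto simp: eq split: if_splits)
        then show ?thesis using x False S.reachable_adj_trans by blast
      qed
    qed
  qed
  show ?thesis
  proof
    show "verts ?S \<noteq> {}" using assms by (auto simp: eq smoothable_def)
    show "x \<rightarrow>\<^sup>*\<^bsub>?S\<^esub> y" if "x \<in> verts ?S" "y \<in> verts ?S" for x y
      using that bypass[of x y] assms(2) by (auto simp: eq strongly_connected_def)
  qed
qed

lemma arcs_at_smooth: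
  assumes "in_arcs \<Gamma> v = {e}" "out_arcs \<Gamma> v = {f}" "tail \<Gamma> e \<noteq> v" "u \<noteq> v"
  shows "out_arcs (smooth \<Gamma> v) u = out_arcs \<Gamma> u"
    and "in_arcs (smooth \<Gamma> v) u = (if f \<in> in_arcs \<Gamma> u then insert e (in_arcs \<Gamma> u - {f}) else in_arcs \<Gamma> u)"
proof -
  have "e \<in> arcs \<Gamma>" "head \<Gamma> e = v" "f \<in> arcs \<Gamma>" "tail \<Gamma> f = v"
    using assms by (auto simp: set_eq_iff)
  then show "out_arcs (smooth \<Gamma> v) u = out_arcs \<Gamma> u"
    and "in_arcs (smooth \<Gamma> v) u = (if f \<in> in_arcs \<Gamma> u then insert e (in_arcs \<Gamma> u - {f}) else in_arcs \<Gamma> u)"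
    using assms(3,4) unfolding smooth_eq[OF assms(1,2)] by (auto split: if_splits)
qed

lemma smoothable_smooth:
  assumes "fin_digraph \<Gamma>" "strongly_connected \<Gamma>" "p \<in> verts \<Gamma>" "smoothable p \<Gamma> v"
    and "smoothable p \<Gamma> u" "u \<noteq> v"
  shows "smoothable p (smooth \<Gamma> v) u"
proof -
  from assms(1-4) obtain e f where ef: "in_arcs \<Gamma> v = {e}" "out_arcs \<Gamma> v = {f}" "tail \<Gamma> e \<noteq> v"
    and eq: "smooth \<Gamma> v = \<lparr> verts = verts \<Gamma> - {v}, arcs = arcs \<Gamma> - {f},
        tail = tail \<Gamma>, head = (head \<Gamma>)(e := head \<Gamma> f) \<rparr>"
    by (rule smoothable_strongly_connectedE)
  obtain e' f' where ef': "in_arcs \<Gamma> u = {e'}" "out_arcs \<Gamma> u = {f'}"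
    using assms(5) by (rule smoothable_arcs)
  have "in_arcs (smooth \<Gamma> v) u = {if f = e' then e else e'}" "out_arcs (smooth \<Gamma> v) u = {f'}"
    unfolding arcs_at_smooth[OF ef assms(6)] ef' by auto
  moreover have "u \<in> verts (smooth \<Gamma> v)" "u \<noteq> p"
    using assms(5,6) by (auto simp: eq smoothable_def)
  ultimately show ?thesis by (simp add: smoothable_def in_degree_def out_degree_def)
qed

text \<open>If no arc joins \<open>u\<close> and \<open>v\<close>, the two smoothings touch different arcs. If \<open>u\<close> and \<open>v\<close> are
consecutive on a path with arcs \<open>a\<close>, \<open>b\<close>, \<open>c\<close>, then both orders keep the name \<open>a\<close> for the arc
that replaces the path, because a smoothing keeps the name of the inward arc.\<close>

lemma smooth_commute:
  assumes "fin_digraph \<Gamma>" "strongly_connected \<Gamma>" "p \<in> verts \<Gamma>"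
    and u: "smoothable p \<Gamma> u" and v: "smoothable p \<Gamma> v" and "u \<noteq> v"
  shows "same_graph (smooth (smooth \<Gamma> u) v) (smooth (smooth \<Gamma> v) u)"
proof -
  from assms(1-3) u obtain e1 f1 where ef1: "in_arcs \<Gamma> u = {e1}" "out_arcs \<Gamma> u = {f1}"
    "tail \<Gamma> e1 \<noteq> u" "head \<Gamma> f1 \<noteq> u"
    and eq1: "smooth \<Gamma> u = \<lparr> verts = verts \<Gamma> - {u}, arcs = arcs \<Gamma> - {f1},
        tail = tail \<Gamma>, head = (head \<Gamma>)(e1 := head \<Gamma> f1) \<rparr>"
    by (rule smoothable_strongly_connectedE)
  from assms(1-3) v obtain e2 f2 where ef2: "in_arcs \<Gamma> v = {e2}" "out_arcs \<Gamma> v = {f2}"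
    "tail \<Gamma> e2 \<noteq> v" "head \<Gamma> f2 \<noteq> v"
    and eq2: "smooth \<Gamma> v = \<lparr> verts = verts \<Gamma> - {v}, arcs = arcs \<Gamma> - {f2},
        tail = tail \<Gamma>, head = (head \<Gamma>)(e2 := head \<Gamma> f2) \<rparr>"
    by (rule smoothable_strongly_connectedE)
  have "e1 \<in> arcs \<Gamma>" "head \<Gamma> e1 = u" "e2 \<in> arcs \<Gamma>" "head \<Gamma> e2 = v"
    "f1 \<in> arcs \<Gamma>" "tail \<Gamma> f1 = u" "f2 \<in> arcs \<Gamma>" "tail \<Gamma> f2 = v"
    using ef1(1,2) ef2(1,2) by (auto simp: set_eq_iff)
  note ends = this
  have in_v: "in_arcs (smooth \<Gamma> u) v = {if f1 = e2 then e1 else e2}"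
    and out_v: "out_arcs (smooth \<Gamma> u) v = {f2}"
    using arcs_at_smooth[OF ef1(1-3), of v] \<open>u \<noteq> v\<close> ef2 by auto
  have in_u: "in_arcs (smooth \<Gamma> v) u = {if f2 = e1 then e2 else e1}"
    and out_u: "out_arcs (smooth \<Gamma> v) u = {f1}"
    using arcs_at_smooth[OF ef2(1-3), of u] \<open>u \<noteq> v\<close> ef1 by auto
  \<comment> \<open>Otherwise \<open>u\<close> and \<open>v\<close> would form a 2-cycle cut off from \<open>p\<close>.\<close>
  have no_cycle: "\<not> (f1 = e2 \<and> f2 = e1)"
  proof
    assume c: "f1 = e2 \<and> f2 = e1"
    have "p \<in> verts (smooth \<Gamma> u)" using assms(3) u by (auto simp: eq1 smoothable_def)
    with assms have "fin_digraph (smooth \<Gamma> u)" "strongly_connected (smooth \<Gamma> u)"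
      "p \<in> verts (smooth \<Gamma> u)" "smoothable p (smooth \<Gamma> u) v"
      by (auto intro: fin_digraph_smooth strongly_connected_smooth smoothable_smooth)
    then obtain e f where "in_arcs (smooth \<Gamma> u) v = {e}" "out_arcs (smooth \<Gamma> u) v = {f}"
      "head (smooth \<Gamma> u) e = v" "head (smooth \<Gamma> u) f \<noteq> v"
      by (rule smoothable_strongly_connectedE)
    then show False using in_v out_v c by auto
  qed
  show ?thesis
    unfolding smooth_eq[OF in_v out_v] smooth_eq[OF in_u out_u] unfolding eq1 eq2
    using ends \<open>u \<noteq> v\<close> no_cycle by (auto simp: same_graph_def)
qed

lemma phi_smoothable:
  assumes "fin_digraph \<Gamma>" "strongly_connected \<Gamma>" "smoothable p \<Gamma> v"
  shows "phi p \<Gamma> = phi p (smooth \<Gamma> (SOME v. smoothable p \<Gamma> v))"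
proof -
  have "verts \<Gamma> \<noteq> {p}" "\<exists>v. smoothable p \<Gamma> v" using assms(3) by (auto simp: smoothable_def)
  then show ?thesis using assms(1,2) by (simp add: phi.simps[of p \<Gamma>])
qed

text \<open>By induction on the number of vertices: the recursion smooths some vertex \<open>u\<close>. For another
smoothable \<open>v\<close>, the induction hypothesis lets \<open>v\<close> be smoothed after \<open>u\<close>, and \<open>u\<close> after \<open>v\<close>; these
two graphs coincide.\<close>

lemma phi_smooth:
  assumes "fin_digraph \<Gamma>" "strongly_connected \<Gamma>" "p \<in> verts \<Gamma>" "smoothable p \<Gamma> v"
  shows "phi p \<Gamma> = phi p (smooth \<Gamma> v)"
  using assms
proof (induction "card (verts \<Gamma>)" arbitrary: \<Gamma> v rule: less_induct)
  case less
  interpret fin_digraph \<Gamma> by fact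
  define u where "u = (SOME v. smoothable p \<Gamma> v)"
  have u: "smoothable p \<Gamma> u" unfolding u_def by (rule someI) (rule less.prems)
  have eq: "phi p \<Gamma> = phi p (smooth \<Gamma> u)"
    unfolding u_def using less.prems by (intro phi_smoothable)
  show ?case
  proof (cases "u = v")
    case False
    have step: "phi p (smooth \<Gamma> x) = phi p (smooth (smooth \<Gamma> x) y)"
      if x: "smoothable p \<Gamma> x" and y: "smoothable p \<Gamma> y" and "x \<noteq> y" for x y
    proof (rule less.hyps)
      note \<Gamma> = less.prems(1-3)
      have eq: "verts (smooth \<Gamma> x) = verts \<Gamma> - {x}" by (simp add: smooth_def Let_def)
      have x': "x \<in> verts \<Gamma>" "x \<noteq> p" using x by (simp_all add: smoothable_def)
      show "card (verts (smooth \<Gamma> x)) < card (verts \<Gamma>)"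
        unfolding eq using finite_verts x'(1) by (rule card_Diff1_less)
      show "p \<in> verts (smooth \<Gamma> x)" unfolding eq using \<Gamma>(3) x'(2) by blast
      show "fin_digraph (smooth \<Gamma> x)" using \<Gamma> x by (rule fin_digraph_smooth)
      show "strongly_connected (smooth \<Gamma> x)" using \<Gamma> x by (rule strongly_connected_smooth)
      show "smoothable p (smooth \<Gamma> x) y" using \<Gamma> x y \<open>x \<noteq> y\<close>[symmetric] by (rule smoothable_smooth)
    qed
    have "phi p \<Gamma> = phi p (smooth (smooth \<Gamma> u) v)"
      using eq step[OF u less.prems(4)] False by simp
    also have "\<dots> = phi p (smooth (smooth \<Gamma> v) u)"
      using less.prems u False by (intro phi_same_graph smooth_commute)
    also have "\<dots> = phi p (smooth \<Gamma> v)"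
      using step[OF less.prems(4) u] False by simp
    finally show ?thesis .
  qed (use eq in simp)
qed

section \<open>Normalisation of \<open>phi\<close> by the cycle rank\<close>

text \<open>The subtraction does not truncate when the graph is strongly connected, and \<open>phi\<close> vanishes on the
other graphs, so a truncated rank does no harm in the definition of \<open>psi\<close> below.\<close>

definition cycle_rank :: "('a, 'b) pre_digraph \<Rightarrow> nat" where
  "cycle_rank \<Gamma> = card (arcs \<Gamma>) + 1 - card (verts \<Gamma>)"

text \<open>In this normalisation the rules of the recursion become uniform: bouquets of loops have value 1,
smoothing changes nothing, and the values after the deletion of single arcs add up to the value
times the cycle rank (\<open>psi_del_arc\<close>).\<close>

definition psi :: "'a \<Rightarrow> ('a, 'b) pre_digraph \<Rightarrow> real" where
  "psi p \<Gamma> = real (phi p \<Gamma>) / fact (cycle_rank \<Gamma>)"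

lemma psi_not_strongly_connected:
  "\<not> strongly_connected \<Gamma> \<Longrightarrow> psi p \<Gamma> = 0"
  by (simp add: psi_def phi.simps[of p \<Gamma>])

lemma psi_smooth:
  assumes "fin_digraph \<Gamma>" "strongly_connected \<Gamma>" "p \<in> verts \<Gamma>" "smoothable p \<Gamma> v"
  shows "psi p \<Gamma> = psi p (smooth \<Gamma> v)"
proof -
  interpret fin_digraph \<Gamma> by fact
  from assms obtain e f where ef: "f \<in> arcs \<Gamma>"
    and eq: "smooth \<Gamma> v = \<lparr> verts = verts \<Gamma> - {v}, arcs = arcs \<Gamma> - {f},
        tail = tail \<Gamma>, head = (head \<Gamma>)(e := head \<Gamma> f) \<rparr>"
    by (rule smoothable_strongly_connectedE)
  have "v \<in> verts \<Gamma>" using assms(4) by (simp add: smoothable_def)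
  moreover have "card (verts \<Gamma>) > 0" "card (arcs \<Gamma>) > 0"
    using ef \<open>v \<in> verts \<Gamma>\<close> by (auto simp: card_gt_0_iff)
  ultimately have "cycle_rank (smooth \<Gamma> v) = cycle_rank \<Gamma>"
    using ef by (simp add: cycle_rank_def eq)
  then show ?thesis using phi_smooth[OF assms] by (simp add: psi_def)
qed

text \<open>In a strongly connected graph with at least two vertices every vertex is the tail of some arc.\<close>

lemma strongly_connected_card:
  assumes "fin_digraph \<Gamma>" "strongly_connected \<Gamma>" "p \<in> verts \<Gamma>" "verts \<Gamma> \<noteq> {p}"
  shows "card (verts \<Gamma>) \<le> card (arcs \<Gamma>)"
proof -
  interpret fin_digraph \<Gamma> by fact
  have "verts \<Gamma> \<subseteq> tail \<Gamma> ` arcs \<Gamma>"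
  proof
    fix x assume x: "x \<in> verts \<Gamma>"
    have "\<exists>y\<in>verts \<Gamma>. y \<noteq> x" using x assms(3,4) by (cases "x = p") auto
    then obtain y where "y \<in> verts \<Gamma>" "y \<noteq> x" by blast
    then have "x \<rightarrow>\<^sup>*\<^bsub>\<Gamma>\<^esub> y" using assms(2) x by (auto simp: strongly_connected_def)
    then show "x \<in> tail \<Gamma> ` arcs \<Gamma>"
      by (rule converse_reachable_cases) (use \<open>y \<noteq> x\<close> in auto)
  qed
  then show ?thesis by (meson card_image_le card_mono finite_arcs finite_imageI le_trans)
qed

text \<open>Deleting an arc lowers the cycle rank \<open>r\<close> by one, and the factor \<open>r\<close> turns \<open>1/r!\<close> into
\<open>1/(r-1)!\<close>. The bouquets of loops obey the same law, all values being 1, although the recursion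
treats them by a separate rule; so among the strongly connected graphs only those with a smoothable
vertex are excluded.\<close>

lemma psi_del_arc:
  assumes "fin_digraph \<Gamma>" "strongly_connected \<Gamma>" "p \<in> verts \<Gamma>" "\<And>v. \<not> smoothable p \<Gamma> v"
  shows "(\<Sum>e\<in>arcs \<Gamma>. psi p (pre_digraph.del_arc \<Gamma> e)) = real (cycle_rank \<Gamma>) * psi p \<Gamma>"
proof -
  interpret fin_digraph \<Gamma> by fact
  show ?thesis
  proof (cases "verts \<Gamma> = {p}")
    case True
    have "psi p (del_arc e) = 1" if "e \<in> arcs \<Gamma>" for e
    proof -
      interpret D: fin_digraph "del_arc e" by (rule fin_digraph_del_arc)
      have "strongly_connected (del_arc e)"
        using True by (intro strongly_connectedI) auto
      then show ?thesis
        using True D.fin_digraph that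
        by (simp add: psi_def cycle_rank_def phi.simps[of p "del_arc e"])
    qed
    moreover have "psi p \<Gamma> = 1"
      using True assms by (simp add: psi_def cycle_rank_def phi.simps[of p \<Gamma>])
    moreover have "cycle_rank \<Gamma> = card (arcs \<Gamma>)" using True by (simp add: cycle_rank_def)
    ultimately show ?thesis by simp
  next
    case False
    then have le: "card (verts \<Gamma>) \<le> card (arcs \<Gamma>)"
      using assms by (intro strongly_connected_card)
    then have rank: "cycle_rank \<Gamma> = Suc (card (arcs \<Gamma>) - card (verts \<Gamma>))"
      by (simp add: cycle_rank_def)
    have "psi p (del_arc e) = real (phi p (del_arc e)) / fact (card (arcs \<Gamma>) - card (verts \<Gamma>))"
      if "e \<in> arcs \<Gamma>" for e
    proof -
      have "card (arcs \<Gamma>) > 0" using that by (auto simp: card_gt_0_iff)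
      then show ?thesis using that by (simp add: psi_def cycle_rank_def)
    qed
    moreover have "\<not> (\<exists>v. smoothable p \<Gamma> v)" using assms(4) by blast
    then have "phi p \<Gamma> = (\<Sum>e\<in>arcs \<Gamma>. phi p (del_arc e))"
      using False assms(1,2) by (simp only: phi.simps[of p \<Gamma>] if_False not_not simp_thms)
    moreover have "real (cycle_rank \<Gamma>) * psi p \<Gamma> =
        real (phi p \<Gamma>) / fact (card (arcs \<Gamma>) - card (verts \<Gamma>))"
      by (simp add: psi_def rank del: of_nat_Suc)
    ultimately show ?thesis
      by (simp add: sum_divide_distrib)
  qed
qed

section \<open>Multiplicativity under one-point unions\<close>

text \<open>The one-point union of \<open>\<Gamma>1\<close> and \<open>\<Gamma>2\<close> at \<open>p\<close>. It is a relation between three graphs, so that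
smoothing at a vertex or deleting an arc of \<open>\<Gamma>1\<close> can be performed on \<open>\<Gamma>\<close> and on \<open>\<Gamma>1\<close> alike
without constructing the union anew.\<close>

definition wedge ::
  "'a \<Rightarrow> ('a, 'b) pre_digraph \<Rightarrow> ('a, 'b) pre_digraph \<Rightarrow> ('a, 'b) pre_digraph \<Rightarrow> bool" where
  "wedge p \<Gamma> \<Gamma>1 \<Gamma>2 \<longleftrightarrow> fin_digraph \<Gamma>1 \<and> fin_digraph \<Gamma>2 \<and>
     verts \<Gamma> = verts \<Gamma>1 \<union> verts \<Gamma>2 \<and> verts \<Gamma>1 \<inter> verts \<Gamma>2 = {p} \<and>
     arcs \<Gamma> = arcs \<Gamma>1 \<union> arcs \<Gamma>2 \<and> arcs \<Gamma>1 \<inter> arcs \<Gamma>2 = {} \<and>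
     (\<forall>a\<in>arcs \<Gamma>1. tail \<Gamma> a = tail \<Gamma>1 a \<and> head \<Gamma> a = head \<Gamma>1 a) \<and>
     (\<forall>a\<in>arcs \<Gamma>2. tail \<Gamma> a = tail \<Gamma>2 a \<and> head \<Gamma> a = head \<Gamma>2 a)"

lemma wedge_commute: "wedge p \<Gamma> \<Gamma>1 \<Gamma>2 \<Longrightarrow> wedge p \<Gamma> \<Gamma>2 \<Gamma>1"
  unfolding wedge_def by blast

lemma wedge_fin_digraph:
  assumes "wedge p \<Gamma> \<Gamma>1 \<Gamma>2"
  shows "fin_digraph \<Gamma>"
proof -
  interpret G1: fin_digraph \<Gamma>1 using assms by (simp add: wedge_def)
  interpret G2: fin_digraph \<Gamma>2 using assms by (simp add: wedge_def)
  show ?thesis using assms by unfold_locales (auto simp: wedge_def)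
qed

text \<open>Collapsing the second summand to \<open>p\<close> turns a walk of the wedge into a walk of the first.\<close>

lemma wedge_strongly_connected_left:
  assumes w: "wedge p \<Gamma> \<Gamma>1 \<Gamma>2" and "strongly_connected \<Gamma>"
  shows "strongly_connected \<Gamma>1"
proof -
  interpret G1: fin_digraph \<Gamma>1 using w by (simp add: wedge_def)
  interpret G2: fin_digraph \<Gamma>2 using w by (simp add: wedge_def)
  interpret G: fin_digraph \<Gamma> using w by (rule wedge_fin_digraph)
  define r where "r y = (if y \<in> verts \<Gamma>1 then y else p)" for y
  have collapse: "x \<rightarrow>\<^sup>*\<^bsub>\<Gamma>1\<^esub> r y" if "x \<rightarrow>\<^sup>*\<^bsub>\<Gamma>\<^esub> y" "x \<in> verts \<Gamma>1" for x y
    using that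
  proof (induction rule: G.reachable_induct)
    case base
    then show ?case by (simp add: r_def)
  next
    case (step y y')
    from step(2) obtain a where a: "a \<in> arcs \<Gamma>" "tail \<Gamma> a = y" "head \<Gamma> a = y'" by blast
    show ?case
    proof (cases "a \<in> arcs \<Gamma>1")
      case True
      then have "tail \<Gamma>1 a = y" "head \<Gamma>1 a = y'" using a w by (auto simp: wedge_def)
      moreover from this True have "y \<in> verts \<Gamma>1" "y' \<in> verts \<Gamma>1" by auto
      ultimately have "r y \<rightarrow>\<^bsub>\<Gamma>1\<^esub> r y'"
        unfolding arcs_ends_conv using True by (auto simp: r_def)
      then show ?thesis using step G1.reachable_adj_trans by blast
    next
      case False
      then have "a \<in> arcs \<Gamma>2" "tail \<Gamma>2 a = y" "head \<Gamma>2 a = y'"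
        using a w by (auto simp: wedge_def)
      then have "y \<in> verts \<Gamma>2" "y' \<in> verts \<Gamma>2" by auto
      then have "r y = p" "r y' = p" using w by (auto simp: wedge_def r_def)
      then show ?thesis using step by simp
    qed
  qed
  have sub: "verts \<Gamma>1 \<subseteq> verts \<Gamma>" "p \<in> verts \<Gamma>1" using w by (auto simp: wedge_def)
  show ?thesis
  proof
    show "x \<rightarrow>\<^sup>*\<^bsub>\<Gamma>1\<^esub> y" if "x \<in> verts \<Gamma>1" "y \<in> verts \<Gamma>1" for x y
    proof -
      have "x \<rightarrow>\<^sup>*\<^bsub>\<Gamma>\<^esub> y" using that sub(1) assms(2) by (auto simp: strongly_connected_def)
      then show ?thesis using collapse[of x y] that by (simp add: r_def)
    qed
  qed (use sub(2) in auto)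
qed

lemma wedge_strongly_connected:
  assumes w: "wedge p \<Gamma> \<Gamma>1 \<Gamma>2"
  shows "strongly_connected \<Gamma> \<longleftrightarrow> strongly_connected \<Gamma>1 \<and> strongly_connected \<Gamma>2"
proof
  assume "strongly_connected \<Gamma>"
  with w wedge_commute[OF w] show "strongly_connected \<Gamma>1 \<and> strongly_connected \<Gamma>2"
    by (auto intro: wedge_strongly_connected_left)
next
  assume sc: "strongly_connected \<Gamma>1 \<and> strongly_connected \<Gamma>2"
  interpret G: fin_digraph \<Gamma> using w by (rule wedge_fin_digraph)
  have mono: "x \<rightarrow>\<^sup>*\<^bsub>\<Gamma>\<^esub> y" if "x \<rightarrow>\<^sup>*\<^bsub>\<Delta>\<^esub> y" "\<Delta> = \<Gamma>1 \<or> \<Delta> = \<Gamma>2" for x y \<Delta>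
  proof -
    have arcs: "\<forall>a\<in>arcs \<Delta>. a \<in> arcs \<Gamma> \<and> tail \<Delta> a = tail \<Gamma> a \<and> head \<Delta> a = head \<Gamma> a"
      and verts: "verts \<Delta> \<subseteq> verts \<Gamma>"
      using that(2) w by (auto simp: wedge_def)
    have "arcs_ends \<Delta> \<subseteq> arcs_ends \<Gamma>"
      using arcs by (auto simp: arcs_ends_conv)
    from this verts show ?thesis using that(1) unfolding reachable_def by (rule rtrancl_on_mono)
  qed
  have p: "p \<in> verts \<Gamma>1" "p \<in> verts \<Gamma>2" using w by (auto simp: wedge_def)
  have via: "x \<rightarrow>\<^sup>*\<^bsub>\<Gamma>\<^esub> p \<and> p \<rightarrow>\<^sup>*\<^bsub>\<Gamma>\<^esub> x" if "x \<in> verts \<Gamma>" for x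
  proof -
    have "x \<in> verts \<Gamma>1 \<or> x \<in> verts \<Gamma>2" using w that by (auto simp: wedge_def)
    then obtain \<Delta> where "\<Delta> = \<Gamma>1 \<or> \<Delta> = \<Gamma>2" "x \<in> verts \<Delta>" "p \<in> verts \<Delta>" "strongly_connected \<Delta>"
      using sc p by blast
    then show ?thesis using mono[of \<Delta>] by (meson strongly_connected_def)
  qed
  show "strongly_connected \<Gamma>"
  proof
    show "verts \<Gamma> \<noteq> {}" using p w by (auto simp: wedge_def)
    show "x \<rightarrow>\<^sup>*\<^bsub>\<Gamma>\<^esub> y" if "x \<in> verts \<Gamma>" "y \<in> verts \<Gamma>" for x y
      using via[OF that(1)] via[OF that(2)] G.reachable_trans by blast
  qed
qed

lemma wedge_arcs_at:
  assumes w: "wedge p \<Gamma> \<Gamma>1 \<Gamma>2" and v: "v \<in> verts \<Gamma>1" "v \<noteq> p"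
  shows "in_arcs \<Gamma> v = in_arcs \<Gamma>1 v" "out_arcs \<Gamma> v = out_arcs \<Gamma>1 v"
proof -
  interpret G2: fin_digraph \<Gamma>2 using w by (simp add: wedge_def)
  have "v \<notin> verts \<Gamma>2" using w v by (auto simp: wedge_def)
  then have "\<forall>a\<in>arcs \<Gamma>2. tail \<Gamma>2 a \<noteq> v \<and> head \<Gamma>2 a \<noteq> v"
    using G2.wellformed by blast
  then show "in_arcs \<Gamma> v = in_arcs \<Gamma>1 v" "out_arcs \<Gamma> v = out_arcs \<Gamma>1 v"
    using w unfolding wedge_def in_arcs_def out_arcs_def by (auto; blast)+
qed

lemma wedge_smoothable_left:
  assumes "wedge p \<Gamma> \<Gamma>1 \<Gamma>2" "v \<in> verts \<Gamma>1"
  shows "smoothable p \<Gamma> v \<longleftrightarrow> smoothable p \<Gamma>1 v"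
proof (cases "v = p")
  case False
  have "v \<in> verts \<Gamma>" using assms by (auto simp: wedge_def)
  with assms(2) wedge_arcs_at[OF assms False] show ?thesis
    by (simp add: smoothable_def in_degree_def out_degree_def)
qed (simp add: smoothable_def)

lemma wedge_smooth:
  assumes w: "wedge p \<Gamma> \<Gamma>1 \<Gamma>2" and sc: "strongly_connected \<Gamma>1" and v: "smoothable p \<Gamma>1 v"
  shows "wedge p (smooth \<Gamma> v) (smooth \<Gamma>1 v) \<Gamma>2"
proof -
  have fin: "fin_digraph \<Gamma>1" and p: "p \<in> verts \<Gamma>1" using w by (auto simp: wedge_def)
  from fin sc p v obtain e f where ef: "in_arcs \<Gamma>1 v = {e}" "out_arcs \<Gamma>1 v = {f}"
    "e \<in> arcs \<Gamma>1" "f \<in> arcs \<Gamma>1"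
    by (rule smoothable_strongly_connectedE)
  have v': "v \<in> verts \<Gamma>1" "v \<noteq> p" using v by (auto simp: smoothable_def)
  note at = wedge_arcs_at[OF w v']
  have "fin_digraph (smooth \<Gamma>1 v)" using fin sc p v by (rule fin_digraph_smooth)
  moreover have "v \<notin> verts \<Gamma>2" "e \<notin> arcs \<Gamma>2" "f \<notin> arcs \<Gamma>2"
    using w v' ef by (auto simp: wedge_def)
  ultimately show ?thesis
    using w v' ef(3,4) unfolding wedge_def smooth_eq[OF ef(1,2)] smooth_eq[OF at[unfolded ef(1,2)]]
    by auto
qed

lemma wedge_del_arc:
  assumes "wedge p \<Gamma> \<Gamma>1 \<Gamma>2" "e \<in> arcs \<Gamma>1"
  shows "wedge p (pre_digraph.del_arc \<Gamma> e) (pre_digraph.del_arc \<Gamma>1 e) \<Gamma>2"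
  using assms fin_digraph.fin_digraph_del_arc[of \<Gamma>1 e]
  unfolding wedge_def by (auto simp: pre_digraph.del_arc_simps)

lemma cycle_rank_wedge:
  assumes w: "wedge p \<Gamma> \<Gamma>1 \<Gamma>2" and sc: "strongly_connected \<Gamma>1" "strongly_connected \<Gamma>2"
  shows "cycle_rank \<Gamma> = cycle_rank \<Gamma>1 + cycle_rank \<Gamma>2"
proof -
  have fin: "fin_digraph \<Gamma>1" "fin_digraph \<Gamma>2" and p: "p \<in> verts \<Gamma>1" "p \<in> verts \<Gamma>2"
    using w by (auto simp: wedge_def)
  interpret G1: fin_digraph \<Gamma>1 by fact
  interpret G2: fin_digraph \<Gamma>2 by fact
  have "card (verts \<Gamma>) + 1 = card (verts \<Gamma>1) + card (verts \<Gamma>2)"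
    using card_Un_Int[of "verts \<Gamma>1" "verts \<Gamma>2"] w by (simp add: wedge_def)
  moreover have "card (arcs \<Gamma>) = card (arcs \<Gamma>1) + card (arcs \<Gamma>2)"
    using w by (simp add: wedge_def card_Un_disjoint)
  moreover have "card (verts \<Gamma>1) \<le> card (arcs \<Gamma>1) + 1"
    using strongly_connected_card[OF fin(1) sc(1) p(1)] by (cases "verts \<Gamma>1 = {p}") auto
  moreover have "card (verts \<Gamma>2) \<le> card (arcs \<Gamma>2) + 1"
    using strongly_connected_card[OF fin(2) sc(2) p(2)] by (cases "verts \<Gamma>2 = {p}") auto
  ultimately show ?thesis unfolding cycle_rank_def by linarith
qed

text \<open>By induction on the size of the union. A smoothing or a deletion takes place in one of the summands
and leaves a smaller one-point union. Smoothings are harmless by \<open>psi_smooth\<close>; this is where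
independence of the chosen vertex is needed, since the vertex chosen in the union need not be the
one chosen in the summand. Without smoothable vertices, write \<open>r\<close>, \<open>r1\<close>, \<open>r2\<close> for the cycle ranks.
Then
\<open>r * psi \<Gamma> = (\<Sum>e. psi (\<Gamma> - e)) = r1 * psi \<Gamma>1 * psi \<Gamma>2 + psi \<Gamma>1 * r2 * psi \<Gamma>2\<close>,
a Leibniz rule, and \<open>r = r1 + r2\<close>.\<close>

lemma psi_wedge:
  assumes "wedge p \<Gamma> \<Gamma>1 \<Gamma>2"
  shows "psi p \<Gamma> = psi p \<Gamma>1 * psi p \<Gamma>2"
  using assms
proof (induction "card (verts \<Gamma>) + card (arcs \<Gamma>)" arbitrary: \<Gamma> \<Gamma>1 \<Gamma>2 rule: less_induct)
  case less
  note w = less.prems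
  interpret fin_digraph \<Gamma> using w by (rule wedge_fin_digraph)
  have fin: "fin_digraph \<Gamma>" "fin_digraph \<Gamma>1" "fin_digraph \<Gamma>2"
    and p: "p \<in> verts \<Gamma>" "p \<in> verts \<Gamma>1" "p \<in> verts \<Gamma>2"
    using w fin_digraph by (auto simp: wedge_def)
  show ?case
  proof (cases "strongly_connected \<Gamma>")
    case False
    then have "\<not> strongly_connected \<Gamma>1 \<or> \<not> strongly_connected \<Gamma>2"
      using wedge_strongly_connected[OF w] by blast
    with False show ?thesis by (auto simp: psi_not_strongly_connected)
  next
    case True
    then have sc: "strongly_connected \<Gamma>1" "strongly_connected \<Gamma>2"
      using wedge_strongly_connected[OF w] by auto
    show ?thesis
    proof (cases "\<exists>v. smoothable p \<Gamma> v")
      case smoothable: True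
      then obtain v where v: "smoothable p \<Gamma> v" by blast
      have eq: "verts (smooth \<Gamma> v) = verts \<Gamma> - {v}"
        "arcs (smooth \<Gamma> v) = arcs \<Gamma> - {THE f. f \<in> out_arcs \<Gamma> v}"
        by (simp_all add: smooth_def Let_def)
      have "v \<in> verts \<Gamma>" using v by (simp add: smoothable_def)
      then have "card (verts (smooth \<Gamma> v)) < card (verts \<Gamma>)"
        unfolding eq by (rule card_Diff1_less[OF finite_verts])
      moreover have "card (arcs (smooth \<Gamma> v)) \<le> card (arcs \<Gamma>)"
        unfolding eq by (rule card_Diff1_le)
      ultimately have "card (verts (smooth \<Gamma> v)) + card (arcs (smooth \<Gamma> v)) < card (verts \<Gamma>) + card (arcs \<Gamma>)"
        by linarith
      then have IH: "psi p (smooth \<Gamma> v) = psi p \<Delta>1 * psi p \<Delta>2" if "wedge p (smooth \<Gamma> v) \<Delta>1 \<Delta>2" for \<Delta>1 \<Delta>2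
        using that by (rule less.hyps)
      have "psi p \<Gamma> = psi p (smooth \<Gamma> v)" using fin(1) True p(1) v by (rule psi_smooth)
      moreover consider "v \<in> verts \<Gamma>1" | "v \<in> verts \<Gamma>2"
        using w v by (auto simp: wedge_def smoothable_def)
      then have "psi p (smooth \<Gamma> v) = psi p \<Gamma>1 * psi p \<Gamma>2"
      proof cases
        case 1
        then have "smoothable p \<Gamma>1 v" using wedge_smoothable_left[OF w] v by blast
        then show ?thesis
          using IH[OF wedge_smooth[OF w sc(1)]] psi_smooth[OF fin(2) sc(1) p(2)] by simp
      next
        case 2
        then have "smoothable p \<Gamma>2 v" using wedge_smoothable_left[OF wedge_commute[OF w]] v by blast
        then show ?thesis
          using IH[OF wedge_smooth[OF wedge_commute[OF w] sc(2)]] psi_smooth[OF fin(3) sc(2) p(3)]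
          by (simp add: mult.commute)
      qed
      ultimately show ?thesis by simp
    next
      case no_smoothable: False
      have no: "\<not> smoothable p \<Gamma>1 v" "\<not> smoothable p \<Gamma>2 v" for v
        using no_smoothable wedge_smoothable_left[OF w, of v]
          wedge_smoothable_left[OF wedge_commute[OF w], of v]
        by (auto simp: smoothable_def)
      have IH: "psi p (del_arc e) = psi p \<Delta>1 * psi p \<Delta>2"
        if "e \<in> arcs \<Gamma>" "wedge p (del_arc e) \<Delta>1 \<Delta>2" for e \<Delta>1 \<Delta>2
      proof (rule less.hyps)
        show "card (verts (del_arc e)) + card (arcs (del_arc e)) < card (verts \<Gamma>) + card (arcs \<Gamma>)"
          using that(1) card_Diff1_less[OF finite_arcs] by simp
      qed fact
      have "real (cycle_rank \<Gamma>) * psi p \<Gamma> = (\<Sum>e\<in>arcs \<Gamma>. psi p (del_arc e))"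
        using psi_del_arc[OF fin(1) True p(1)] no_smoothable by simp
      also have "\<dots> = (\<Sum>e\<in>arcs \<Gamma>1. psi p (del_arc e)) + (\<Sum>e\<in>arcs \<Gamma>2. psi p (del_arc e))"
        using w finite_arcs by (simp add: wedge_def sum.union_disjoint)
      also have "(\<Sum>e\<in>arcs \<Gamma>1. psi p (del_arc e)) =
          (\<Sum>e\<in>arcs \<Gamma>1. psi p (pre_digraph.del_arc \<Gamma>1 e)) * psi p \<Gamma>2"
        unfolding sum_distrib_right
        using w by (intro sum.cong IH wedge_del_arc) (auto simp: wedge_def)
      also have "\<dots> = real (cycle_rank \<Gamma>1) * psi p \<Gamma>1 * psi p \<Gamma>2"
        using psi_del_arc[OF fin(2) sc(1) p(2)] no by simp
      also have "(\<Sum>e\<in>arcs \<Gamma>2. psi p (del_arc e)) =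
          (\<Sum>e\<in>arcs \<Gamma>2. psi p (pre_digraph.del_arc \<Gamma>2 e)) * psi p \<Gamma>1"
        unfolding sum_distrib_right
        using w wedge_commute[OF w]
        by (intro sum.cong IH wedge_commute[OF wedge_del_arc] wedge_del_arc) (auto simp: wedge_def)
      also have "\<dots> = real (cycle_rank \<Gamma>2) * psi p \<Gamma>2 * psi p \<Gamma>1"
        using psi_del_arc[OF fin(3) sc(2) p(3)] no by simp
      finally have "real (cycle_rank \<Gamma>) * psi p \<Gamma> = real (cycle_rank \<Gamma>) * (psi p \<Gamma>1 * psi p \<Gamma>2)"
        using cycle_rank_wedge[OF w sc] by (simp add: algebra_simps)
      \<comment> \<open>The rank cannot be cancelled if it is 0; then all three graphs are the single vertex \<open>p\<close>.\<close>
      moreover have "psi p \<Gamma> = psi p \<Gamma>1 * psi p \<Gamma>2" if "cycle_rank \<Gamma> = 0"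
      proof -
        have one: "psi p \<Delta> = 1" if "fin_digraph \<Delta>" "strongly_connected \<Delta>" "p \<in> verts \<Delta>" "cycle_rank \<Delta> = 0"
          for \<Delta> :: "('a, 'b) pre_digraph"
        proof -
          have "verts \<Delta> = {p}"
            using strongly_connected_card[OF that(1-3)] that(4) by (force simp: cycle_rank_def)
          with that show ?thesis by (simp add: psi_def cycle_rank_def phi.simps[of p \<Delta>])
        qed
        from that cycle_rank_wedge[OF w sc] have "cycle_rank \<Gamma>1 = 0" "cycle_rank \<Gamma>2 = 0" by auto
        then show ?thesis
          using one[OF fin(1) True p(1) that] one[OF fin(2) sc(1) p(2)] one[OF fin(3) sc(2) p(3)] by simp
      qed
      ultimately show ?thesis by (cases "cycle_rank \<Gamma> = 0") auto
    qed
  qed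
qed

section \<open>Edge-cuttings of a disjoint union\<close>

text \<open>The sum over edge-cuttings in the definition of \<open>z\<close>: the factorial there is the one that
normalises \<open>phi\<close>, since \<open>|C| + w(G)\<close> is the cycle rank of \<open>cut_graph G C\<close>.\<close>

definition cut_sum :: "('a, 'b) pre_digraph \<Rightarrow> real" where
  "cut_sum G = (\<Sum>C\<in>Pow (arcs G). (-1) ^ card C * psi None (cut_graph G C))"

lemma card_arcs_cut_graph:
  assumes "finite (arcs G)" "C \<subseteq> arcs G"
  shows "card (arcs (cut_graph G C)) = card (arcs G) + card C"
proof -
  have C: "finite C" using assms finite_subset by blast
  have "card (arcs (cut_graph G C)) = card (Whole ` (arcs G - C)) + card (Out_End ` C) + card (In_End ` C)"
    using assms C unfolding cut_graph_def pre_digraph.simps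
    by (subst card_Un_disjoint; (subst card_Un_disjoint)?; auto)
  also have "\<dots> = card (arcs G - C) + card C + card C"
    by (simp add: card_image inj_on_def)
  also have "\<dots> = card (arcs G) + card C"
    using assms card_mono[OF assms] by (simp add: card_Diff_subset[OF C])
  finally show ?thesis .
qed

lemma cycle_rank_cut_graph:
  assumes "fin_digraph G" "C \<subseteq> arcs G"
  shows "cycle_rank (cut_graph G C) = nat (int (card C) + weight G)"
proof -
  interpret fin_digraph G by fact
  have "card (verts (cut_graph G C)) = Suc (card (verts G))"
    by (simp add: cut_graph_def card_image inj_on_def)
  then show ?thesis
    using card_arcs_cut_graph[OF finite_arcs assms(2)] by (simp add: cycle_rank_def weight_def)
qed

lemma z_eq_cut_sum:
  assumes "fin_digraph G"
  shows "z G = (-1) ^ card (verts G) * 2 powi weight G / real (card (Aut G)) * cut_sum G"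
proof -
  have "cut_sum G = (\<Sum>C\<in>Pow (arcs G). (-1) ^ card C * real (phi None (cut_graph G C)) /
      fact (nat (int (card C) + weight G)))"
    unfolding cut_sum_def
    by (intro sum.cong) (auto simp: psi_def cycle_rank_cut_graph[OF assms])
  then show ?thesis by (simp add: z_def)
qed

lemma fin_digraph_cut_graph:
  assumes "fin_digraph G" "C \<subseteq> arcs G"
  shows "fin_digraph (cut_graph G C)"
proof -
  interpret fin_digraph G by fact
  have "finite C" using assms(2) finite_arcs by (rule finite_subset)
  then show ?thesis using assms(2) by unfold_locales (auto simp: cut_graph_def)
qed

lemma wedge_cut_graph_union:
  assumes "fin_digraph G1" "fin_digraph G2" "compatible G1 G2"
    and "verts G1 \<inter> verts G2 = {}" "arcs G1 \<inter> arcs G2 = {}"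
    and "C1 \<subseteq> arcs G1" "C2 \<subseteq> arcs G2"
  shows "wedge None (cut_graph (union G1 G2) (C1 \<union> C2)) (cut_graph G1 C1) (cut_graph G2 C2)"
proof -
  have diff: "arcs G1 \<union> arcs G2 - (C1 \<union> C2) = (arcs G1 - C1) \<union> (arcs G2 - C2)"
    using assms(5-7) by blast
  let ?U = "cut_graph (union G1 G2) (C1 \<union> C2)"
  have ends: "tail (union G1 G2) = tail G1" "head (union G1 G2) = head G1"
    "tail G2 = tail G1" "head G2 = head G1"
    using assms(3) by (simp_all add: union_def compatible_def)
  show ?thesis
    unfolding wedge_def
  proof (intro conjI)
    show "fin_digraph (cut_graph G1 C1)" "fin_digraph (cut_graph G2 C2)"
      using assms(1,2,6,7) by (auto intro: fin_digraph_cut_graph)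
    show "verts ?U = verts (cut_graph G1 C1) \<union> verts (cut_graph G2 C2)"
      by (auto simp: cut_graph_def union_def)
    show "verts (cut_graph G1 C1) \<inter> verts (cut_graph G2 C2) = {None}"
      using assms(4) by (auto simp: cut_graph_def)
    show "arcs ?U = arcs (cut_graph G1 C1) \<union> arcs (cut_graph G2 C2)"
      by (simp add: cut_graph_def union_def diff image_Un Un_ac)
    show "arcs (cut_graph G1 C1) \<inter> arcs (cut_graph G2 C2) = {}"
      using assms(5-7) by (auto simp: cut_graph_def)
  qed (auto simp: cut_graph_def ends)
qed

text \<open>An edge-cutting of a disjoint union is a pair of edge-cuttings of the parts, and the cut graph is
the one-point union of the two cut graphs at the new vertex.\<close>

lemma cut_sum_union:
  assumes "fin_digraph G1" "fin_digraph G2" "compatible G1 G2"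
    and disj: "verts G1 \<inter> verts G2 = {}" "arcs G1 \<inter> arcs G2 = {}"
  shows "cut_sum (union G1 G2) = cut_sum G1 * cut_sum G2"
proof -
  interpret G1: fin_digraph G1 by fact
  interpret G2: fin_digraph G2 by fact
  let ?t = "\<lambda>G C. (-1) ^ card C * psi None (cut_graph G C)"
  have bij: "bij_betw (\<lambda>(C1, C2). C1 \<union> C2) (Pow (arcs G1) \<times> Pow (arcs G2)) (Pow (arcs (union G1 G2)))"
    using disj(2)
    by (intro bij_betw_byWitness[where f' = "\<lambda>C. (C \<inter> arcs G1, C \<inter> arcs G2)"])
      (auto simp: union_def)
  have "cut_sum (union G1 G2) =
      (\<Sum>(C1, C2)\<in>Pow (arcs G1) \<times> Pow (arcs G2). ?t (union G1 G2) (C1 \<union> C2))"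
    unfolding cut_sum_def
    by (subst sum.reindex_bij_betw[OF bij, symmetric]) (simp add: case_prod_unfold)
  also have "\<dots> = (\<Sum>(C1, C2)\<in>Pow (arcs G1) \<times> Pow (arcs G2). ?t G1 C1 * ?t G2 C2)"
  proof (intro sum.cong refl, clarify)
    fix C1 C2 assume C: "C1 \<subseteq> arcs G1" "C2 \<subseteq> arcs G2"
    have "finite C1" using C(1) G1.finite_arcs by (rule finite_subset)
    moreover have "finite C2" using C(2) G2.finite_arcs by (rule finite_subset)
    moreover have "C1 \<inter> C2 = {}" using C disj by auto
    ultimately have "card (C1 \<union> C2) = card C1 + card C2" by (rule card_Un_disjoint)
    then show "?t (union G1 G2) (C1 \<union> C2) = ?t G1 C1 * ?t G2 C2"
      using psi_wedge[OF wedge_cut_graph_union[OF assms C]] by (simp add: power_add)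
  qed
  also have "\<dots> = cut_sum G1 * cut_sum G2"
    by (simp add: cut_sum_def sum_product sum.cartesian_product)
  finally show ?thesis .
qed

lemma cut_sum_empty:
  assumes "verts G = {}" "arcs G = {}"
  shows "cut_sum G = 1"
proof -
  have sc: "fin_digraph (cut_graph G {})"
    using assms by unfold_locales (auto simp: cut_graph_def)
  then interpret fin_digraph "cut_graph G {}" .
  have verts: "verts (cut_graph G {}) = {None}"
    using assms by (simp add: cut_graph_def)
  then have "strongly_connected (cut_graph G {})"
    by (intro strongly_connectedI) auto
  with verts have "psi None (cut_graph G {}) = 1"
    using assms sc by (simp add: psi_def phi.simps[of None "cut_graph G {}"] cycle_rank_def)
  then show ?thesis by (simp add: cut_sum_def assms)
qed

section \<open>Decomposition into connected components\<close>

locale disjoint_components =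
  fixes G :: "('a, 'b) pre_digraph" and H :: "nat \<Rightarrow> ('a, 'b) pre_digraph" and k :: nat
  assumes fin: "fin_digraph G"
    and sub: "i \<in> {1..k} \<Longrightarrow> subgraph (H i) G"
    and conn: "i \<in> {1..k} \<Longrightarrow> Digraph_Component.connected (H i)"
    and disj: "i \<in> {1..k} \<Longrightarrow> j \<in> {1..k} \<Longrightarrow> i \<noteq> j \<Longrightarrow> verts (H i) \<inter> verts (H j) = {}"
    and verts_eq: "verts G = (\<Union>i\<in>{1..k}. verts (H i))"
    and arcs_eq: "arcs G = (\<Union>i\<in>{1..k}. arcs (H i))"
begin

lemma fin_H: "i \<in> {1..k} \<Longrightarrow> fin_digraph (H i)"
  using fin sub by (rule fin_digraph.fin_digraph_subgraph)

lemma ends_H: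
  assumes "i \<in> {1..k}"
  shows "tail (H i) = tail G" "head (H i) = head G"
  using sub[OF assms] by (auto simp: subgraph_def compatible_def)

lemma ends_in_H:
  assumes "i \<in> {1..k}" "e \<in> arcs (H i)"
  shows "tail G e \<in> verts (H i)" "head G e \<in> verts (H i)"
  using fin_H[OF assms(1)] assms ends_H[OF assms(1)]
  by (metis fin_digraph_def wf_digraph.tail_in_verts wf_digraph.head_in_verts)+

lemma index_unique:
  assumes "i \<in> {1..k}" "j \<in> {1..k}" "x \<in> verts (H i)" "x \<in> verts (H j)"
  shows "i = j"
proof (rule ccontr)
  assume "i \<noteq> j"
  then show False using disj[OF assms(1,2)] assms(3,4) by blast
qed

lemma arc_index_unique:
  assumes "i \<in> {1..k}" "j \<in> {1..k}" "e \<in> arcs (H i)" "tail G e \<in> verts (H j)"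
  shows "i = j"
  using assms(1,2) ends_in_H(1)[OF assms(1,3)] assms(4) by (rule index_unique)

lemma disj_arcs:
  assumes "i \<in> {1..k}" "j \<in> {1..k}" "i \<noteq> j"
  shows "arcs (H i) \<inter> arcs (H j) = {}"
proof (rule ccontr)
  assume "arcs (H i) \<inter> arcs (H j) \<noteq> {}"
  then obtain e where "e \<in> arcs (H i)" "e \<in> arcs (H j)" by blast
  then show False
    using arc_index_unique[OF assms(1,2)] ends_in_H(1)[OF assms(2)] assms(3) by blast
qed

lemma H_nonempty:
  assumes "i \<in> {1..k}"
  shows "verts (H i) \<noteq> {}"
  using conn[OF assms] by (auto simp: connected_def strongly_connected_def)

lemma cut_sum_prod: "cut_sum G = (\<Prod>j\<in>{1..k}. cut_sum (H j))"
proof -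
  let ?U = "\<lambda>I. pre_digraph.Union G (H ` I)"
  have *: "fin_digraph (?U I) \<and> cut_sum (?U I) = (\<Prod>j\<in>I. cut_sum (H j))"
    if "finite I" "I \<subseteq> {1..k}" for I
    using that
  proof (induction I rule: finite_induct)
    case empty
    have "fin_digraph (?U {})" by unfold_locales (auto simp: pre_digraph.Union_def)
    moreover have "cut_sum (?U {}) = 1" by (rule cut_sum_empty) (auto simp: pre_digraph.Union_def)
    ultimately show ?case by simp
  next
    case (insert j I)
    then have j: "j \<in> {1..k}" and I: "I \<subseteq> {1..k}" by auto
    have U: "?U (insert j I) = union (H j) (?U I)"
      using ends_H[OF j] by (simp add: pre_digraph.Union_def union_def)
    have IH: "fin_digraph (?U I)" "cut_sum (?U I) = (\<Prod>j\<in>I. cut_sum (H j))"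
      using insert.IH I by auto
    interpret Hj: fin_digraph "H j" using j by (rule fin_H)
    interpret UI: fin_digraph "?U I" by (rule IH)
    have comp: "compatible (H j) (?U I)"
      using ends_H[OF j] by (simp add: compatible_def pre_digraph.Union_def)
    have "fin_digraph (union (H j) (?U I))"
      using comp Hj.wellformed UI.wellformed Hj.finite_verts UI.finite_verts Hj.finite_arcs UI.finite_arcs
      by unfold_locales (auto simp: union_def compatible_def)
    moreover have "verts (H j) \<inter> verts (H i) = {} \<and> arcs (H j) \<inter> arcs (H i) = {}" if "i \<in> I" for i
    proof -
      have "i \<in> {1..k}" "j \<noteq> i" using that I insert(2) by auto
      then show ?thesis using disj[OF j] disj_arcs[OF j] by simp
    qed
    then have "verts (H j) \<inter> verts (?U I) = {}" "arcs (H j) \<inter> arcs (?U I) = {}"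
      by (auto simp: pre_digraph.Union_def)
    then have "cut_sum (union (H j) (?U I)) = cut_sum (H j) * cut_sum (?U I)"
      using comp by (intro cut_sum_union Hj.fin_digraph IH(1))
    ultimately show ?case unfolding U using IH(2) insert(1,2) by simp
  qed
  have "?U {1..k} = G"
    using verts_eq arcs_eq by (simp add: pre_digraph.Union_def)
  with *[of "{1..k}"] show ?thesis by simp
qed

end

section \<open>Automorphisms of a disjoint union\<close>

text \<open>Isomorphisms as pairs of maps; extensionality makes each one occur exactly once, so that they can
be counted. The target graph is given, whereas \<^const>\<open>digraph_iso\<close> lets the isomorphism determine it.\<close>

definition Iso :: "('a, 'b) pre_digraph \<Rightarrow> ('a, 'b) pre_digraph \<Rightarrow> (('a \<Rightarrow> 'a) \<times> ('b \<Rightarrow> 'b)) set" where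
  "Iso G K = {(f, g). f \<in> extensional (verts G) \<and> g \<in> extensional (arcs G) \<and>
     bij_betw f (verts G) (verts K) \<and> bij_betw g (arcs G) (arcs K) \<and>
     (\<forall>e\<in>arcs G. tail K (g e) = f (tail G e) \<and> head K (g e) = f (head G e))}"

lemma Iso_nonempty_iff:
  assumes "wf_digraph G"
  shows "Iso G K \<noteq> {} \<longleftrightarrow> digraph_iso G K"
proof
  interpret wf_digraph G by fact
  assume "Iso G K \<noteq> {}"
  then obtain f g where fg: "bij_betw f (verts G) (verts K)" "bij_betw g (arcs G) (arcs K)"
    "\<forall>e\<in>arcs G. tail K (g e) = f (tail G e) \<and> head K (g e) = f (head G e)"
    by (auto simp: Iso_def)
  let ?h = "\<lparr> iso_verts = f, iso_arcs = g, iso_head = head K, iso_tail = tail K \<rparr>"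
  have "digraph_isomorphism ?h"
    using fg assms by (auto simp: digraph_isomorphism_def bij_betw_def)
  moreover have "K = app_iso ?h G"
    using fg by (simp add: app_iso_def bij_betw_def)
  ultimately show "digraph_iso G K" unfolding digraph_iso_def by blast
next
  interpret wf_digraph G by fact
  assume "digraph_iso G K"
  then obtain h where h: "digraph_isomorphism h" "K = app_iso h G"
    unfolding digraph_iso_def by blast
  have bij: "bij_betw (iso_verts h) (verts G) (verts K)" "bij_betw (iso_arcs h) (arcs G) (arcs K)"
    using h by (simp_all add: digraph_isomorphism_def bij_betw_def)
  have ends: "tail K (iso_arcs h e) = iso_verts h (tail G e) \<and> head K (iso_arcs h e) = iso_verts h (head G e)"
    if "e \<in> arcs G" for e
    using h that by (simp add: digraph_isomorphism_def)
  have "(restrict (iso_verts h) (verts G), restrict (iso_arcs h) (arcs G)) \<in> Iso G K"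
    using bij ends by (simp add: Iso_def cong: bij_betw_cong)
  then show "Iso G K \<noteq> {}" by blast
qed

text \<open>Composition with a fixed isomorphism \<open>(f0, g0)\<close> matches \<open>Aut G\<close> with \<open>Iso G K\<close>.\<close>

lemma card_Iso:
  assumes "wf_digraph G" "Iso G K \<noteq> {}"
  shows "card (Iso G K) = card (Aut G)"
proof -
  interpret wf_digraph G by fact
  obtain f0 g0 where "(f0, g0) \<in> Iso G K" using assms(2) by auto
  then have f0: "bij_betw f0 (verts G) (verts K)" and g0: "bij_betw g0 (arcs G) (arcs K)"
    and fg0: "\<And>e. e \<in> arcs G \<Longrightarrow> tail K (g0 e) = f0 (tail G e)"
      "\<And>e. e \<in> arcs G \<Longrightarrow> head K (g0 e) = f0 (head G e)"
    by (auto simp: Iso_def)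
  let ?\<Phi> = "\<lambda>(a, b). (restrict (f0 \<circ> a) (verts G), restrict (g0 \<circ> b) (arcs G))"
  have "bij_betw ?\<Phi> (Aut G) (Iso G K)"
  proof (rule bij_betw_imageI)
    have cancel: "a = a'"
      if "bij_betw q S T" "a permutes S" "a' permutes S" "restrict (q \<circ> a) S = restrict (q \<circ> a') S"
      for q :: "'c \<Rightarrow> 'c" and S T a a'
    proof
      fix x
      show "a x = a' x"
      proof (cases "x \<in> S")
        case True
        then have "q (a x) = q (a' x)" using that(4) by (metis comp_apply restrict_apply')
        moreover have "a x \<in> S" "a' x \<in> S" using True that(2,3) by (simp_all add: permutes_in_image)
        ultimately show ?thesis using that(1) by (auto simp: bij_betw_def inj_on_def)
      qed (use that(2,3) in \<open>simp add: permutes_not_in\<close>)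
    qed
    show "inj_on ?\<Phi> (Aut G)"
      by (rule inj_onI) (auto simp: Aut_def intro: cancel[OF f0] cancel[OF g0])
    show "?\<Phi> ` Aut G = Iso G K"
    proof (intro equalityI subsetI)
      fix x assume "x \<in> ?\<Phi> ` Aut G"
      then obtain a b where x: "x = ?\<Phi> (a, b)" and ab: "a permutes verts G" "b permutes arcs G"
        "\<forall>e\<in>arcs G. tail G (b e) = a (tail G e) \<and> head G (b e) = a (head G e)"
        by (auto simp: Aut_def)
      have "bij_betw (f0 \<circ> a) (verts G) (verts K)" "bij_betw (g0 \<circ> b) (arcs G) (arcs K)"
        using f0 g0 ab(1,2)[THEN permutes_imp_bij] by (blast intro: bij_betw_trans)+
      moreover have "b e \<in> arcs G" if "e \<in> arcs G" for e
        using that ab(2) by (simp add: permutes_in_image)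
      ultimately show "x \<in> Iso G K"
        using ab(3) fg0 by (auto simp: x Iso_def cong: bij_betw_cong)
    next
      fix x assume "x \<in> Iso G K"
      then obtain f g where x: "x = (f, g)" and ext: "f \<in> extensional (verts G)" "g \<in> extensional (arcs G)"
        and fg: "bij_betw f (verts G) (verts K)" "bij_betw g (arcs G) (arcs K)"
        "\<And>e. e \<in> arcs G \<Longrightarrow> tail K (g e) = f (tail G e)"
        "\<And>e. e \<in> arcs G \<Longrightarrow> head K (g e) = f (head G e)"
        by (auto simp: Iso_def)
      define a where "a v = (if v \<in> verts G then inv_into (verts G) f0 (f v) else v)" for v
      define b where "b e = (if e \<in> arcs G then inv_into (arcs G) g0 (g e) else e)" for e
      have "bij_betw a (verts G) (verts G)" "bij_betw b (arcs G) (arcs G)"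
        using bij_betw_trans[OF fg(1) bij_betw_inv_into[OF f0]]
          bij_betw_trans[OF fg(2) bij_betw_inv_into[OF g0]]
        by (auto simp: a_def b_def comp_def cong: bij_betw_cong)
      then have ab: "a permutes verts G" "b permutes arcs G"
        by (auto intro!: bij_imp_permutes simp: a_def b_def)
      have f0a: "f0 (a v) = f v" if "v \<in> verts G" for v
        using that fg(1) f0 by (auto simp: a_def bij_betw_def intro!: f_inv_into_f)
      have g0b: "g0 (b e) = g e" if "e \<in> arcs G" for e
        using that fg(2) g0 by (auto simp: b_def bij_betw_def intro!: f_inv_into_f)
      have "tail G (b e) = a (tail G e) \<and> head G (b e) = a (head G e)" if e: "e \<in> arcs G" for e
      proof -
        have be: "b e \<in> arcs G" using e ab(2) by (simp add: permutes_in_image)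
        have "a (tail G e) \<in> verts G" "a (head G e) \<in> verts G"
          using e ab(1) by (simp_all add: permutes_in_image)
        moreover have "f0 (tail G (b e)) = f0 (a (tail G e))" "f0 (head G (b e)) = f0 (a (head G e))"
          using fg0[OF be] g0b[OF e] fg(3,4)[OF e] f0a e by simp_all
        ultimately show ?thesis
          using be f0 by (auto simp: bij_betw_def dest: inj_onD)
      qed
      then have "(a, b) \<in> Aut G" using ab by (simp add: Aut_def)
      moreover have "x = ?\<Phi> (a, b)"
        unfolding x using ext f0a g0b by (auto intro!: extensionalityI)
      ultimately show "x \<in> ?\<Phi> ` Aut G" by blast
    qed
  qed
  then show ?thesis by (simp add: bij_betw_same_card)
qed

lemma connected_constant:
  assumes "Digraph_Component.connected G"
    and "\<And>e. e \<in> arcs G \<Longrightarrow> c (tail G e) = c (head G e)"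
    and "u \<in> verts G" "v \<in> verts G"
  shows "c u = c v"
proof -
  have "u \<rightarrow>\<^sup>*\<^bsub>with_proj (mk_symmetric G)\<^esub> v"
    using assms(1,3,4) by (auto simp: connected_def strongly_connected_def)
  then show ?thesis
    unfolding reachable_def
  proof (induction rule: rtrancl_on_induct)
    case (step y y')
    then show ?case using assms(2) by (auto simp: parcs_mk_symmetric)
  qed simp
qed

lemma glue_bijections:
  assumes disj: "\<And>i j x. i \<in> I \<Longrightarrow> j \<in> I \<Longrightarrow> x \<in> X i \<Longrightarrow> x \<in> X j \<Longrightarrow> i = j"
    and \<sigma>: "\<sigma> permutes I" and q: "\<And>i. i \<in> I \<Longrightarrow> bij_betw (q i) (X i) (X (\<sigma> i))"
  obtains f where "f permutes (\<Union>i\<in>I. X i)" "\<forall>i\<in>I. \<forall>x\<in>X i. f x = q i x"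
proof -
  define f where "f x = (if x \<in> (\<Union>i\<in>I. X i) then q (THE i. i \<in> I \<and> x \<in> X i) x else x)" for x
  have f: "f x = q i x" if "i \<in> I" "x \<in> X i" for i x
  proof -
    have "(THE i. i \<in> I \<and> x \<in> X i) = i" using that disj by blast
    then show ?thesis using that by (auto simp: f_def)
  qed
  have img: "q i x \<in> X (\<sigma> i)" if "i \<in> I" "x \<in> X i" for i x
    using q that by (auto simp: bij_betw_def)
  have "bij_betw f (\<Union>i\<in>I. X i) (\<Union>i\<in>I. X i)"
  proof (rule bij_betw_imageI)
    show "inj_on f (\<Union>i\<in>I. X i)"
    proof (rule inj_onI, clarify)
      fix x y i j assume ij: "i \<in> I" "x \<in> X i" "j \<in> I" "y \<in> X j" and eq: "f x = f y"
      have "\<sigma> i \<in> I" "\<sigma> j \<in> I" using ij \<sigma> by (simp_all add: permutes_in_image)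
      moreover have "f x \<in> X (\<sigma> i)" "f x \<in> X (\<sigma> j)" using img ij f eq by metis+
      ultimately have "\<sigma> i = \<sigma> j" by (rule disj)
      then have "i = j" using permutes_inj[OF \<sigma>] by (auto dest: injD)
      then show "x = y" using ij eq f q by (metis bij_betw_inv_into_left)
    qed
    have "f ` (\<Union>i\<in>I. X i) = (\<Union>i\<in>I. q i ` X i)"
      unfolding image_UN using f by (intro SUP_cong refl image_cong) auto
    also have "\<dots> = (\<Union>i\<in>I. X (\<sigma> i))" using q by (intro SUP_cong) (auto simp: bij_betw_def)
    also have "\<dots> = (\<Union>i\<in>I. X i)" using permutes_image[OF \<sigma>] by (metis image_image)
    finally show "f ` (\<Union>i\<in>I. X i) = (\<Union>i\<in>I. X i)" .
  qed
  then have "f permutes (\<Union>i\<in>I. X i)" by (rule bij_imp_permutes) (simp add: f_def)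
  with f show thesis using that by blast
qed

context disjoint_components
begin

definition aut_over :: "(nat \<Rightarrow> nat) \<Rightarrow> (('a \<Rightarrow> 'a) \<times> ('b \<Rightarrow> 'b)) set" where
  "aut_over \<sigma> = {(f, g) \<in> Aut G. \<forall>i\<in>{1..k}. f ` verts (H i) = verts (H (\<sigma> i))}"

text \<open>The map sending a vertex \<open>x\<close> to the index of the component of \<open>f x\<close> is constant along arcs, hence
constant on each connected \<open>H i\<close>. So \<open>f\<close> maps each component into a single one, with indices
given by \<open>s\<close>; surjectivity of \<open>f\<close> makes \<open>s\<close> surjective, thus bijective, and the inclusions equalities.\<close>

lemma Aut_permutes_components:
  assumes "(f, g) \<in> Aut G"
  shows "\<exists>\<sigma>. \<sigma> permutes {1..k} \<and> (f, g) \<in> aut_over \<sigma>"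
proof -
  have f: "f permutes verts G" and g: "g permutes arcs G"
    and fg: "\<And>e. e \<in> arcs G \<Longrightarrow> tail G (g e) = f (tail G e)"
      "\<And>e. e \<in> arcs G \<Longrightarrow> head G (g e) = f (head G e)"
    using assms by (auto simp: Aut_def)
  define c where "c x = (THE i. i \<in> {1..k} \<and> x \<in> verts (H i))" for x
  have c: "c x = i" if "i \<in> {1..k}" "x \<in> verts (H i)" for i x
    unfolding c_def using that index_unique by (intro the_equality) auto
  have c_in: "c x \<in> {1..k}" "x \<in> verts (H (c x))" if "x \<in> verts G" for x
    using that c by (auto simp: verts_eq)
  have V: "verts (H i) \<subseteq> verts G" "arcs (H i) \<subseteq> arcs G" if "i \<in> {1..k}" for i
    using sub[OF that] by (auto simp: subgraph_def)
  have "\<exists>j\<in>{1..k}. f ` verts (H i) \<subseteq> verts (H j)" if i: "i \<in> {1..k}" for i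
  proof -
    obtain u where u: "u \<in> verts (H i)" using H_nonempty[OF i] by blast
    have const: "c (f x) = c (f u)" if x: "x \<in> verts (H i)" for x
    proof (rule connected_constant[where G = "H i" and c = "\<lambda>x. c (f x)"])
      fix e assume e: "e \<in> arcs (H i)"
      then have "g e \<in> arcs G" using V(2)[OF i] g by (auto simp: permutes_in_image)
      then obtain j where j: "j \<in> {1..k}" "g e \<in> arcs (H j)" by (auto simp: arcs_eq)
      then have "c (tail G (g e)) = c (head G (g e))" using ends_in_H c by metis
      then show "c (f (tail (H i) e)) = c (f (head (H i) e))"
        using fg e V(2)[OF i] ends_H[OF i] by auto
    qed (use conn[OF i] u x in auto)
    have fG: "f x \<in> verts G" if "x \<in> verts (H i)" for x
      using that V(1)[OF i] f by (auto simp: permutes_in_image)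
    have "f ` verts (H i) \<subseteq> verts (H (c (f u)))"
    proof clarify
      fix x assume x: "x \<in> verts (H i)"
      show "f x \<in> verts (H (c (f u)))" using c_in(2)[OF fG[OF x]] const[OF x] by simp
    qed
    then show ?thesis using c_in(1)[OF fG[OF u]] by blast
  qed
  then obtain s where s: "\<And>i. i \<in> {1..k} \<Longrightarrow> s i \<in> {1..k} \<and> f ` verts (H i) \<subseteq> verts (H (s i))"
    by metis
  have preimage: "\<exists>i\<in>{1..k}. s i = j \<and> y \<in> f ` verts (H i)" if j: "j \<in> {1..k}" and y: "y \<in> verts (H j)" for j y
  proof -
    obtain x where x: "y = f x" "x \<in> verts G"
      using y V(1)[OF j] permutes_image[OF f] by blast
    then obtain i where i: "i \<in> {1..k}" "x \<in> verts (H i)" by (auto simp: verts_eq)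
    then have "y \<in> verts (H (s i))" using s x by blast
    then have "s i = j" using s i j y by (intro index_unique) auto
    with i x show ?thesis by blast
  qed
  have "s ` {1..k} = {1..k}"
  proof
    show "{1..k} \<subseteq> s ` {1..k}"
      using preimage H_nonempty by fast
  qed (use s in auto)
  then have bij: "bij_betw s {1..k} {1..k}"
    by (simp add: bij_betw_def eq_card_imp_inj_on)
  define \<sigma> where "\<sigma> i = (if i \<in> {1..k} then s i else i)" for i
  have "bij_betw \<sigma> {1..k} {1..k}"
    using bij bij_betw_cong[of "{1..k}" \<sigma> s] by (simp add: \<sigma>_def)
  then have "\<sigma> permutes {1..k}" by (rule bij_imp_permutes) (auto simp: \<sigma>_def)
  moreover have "f ` verts (H i) = verts (H (\<sigma> i))" if i: "i \<in> {1..k}" for i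
  proof
    show "f ` verts (H i) \<subseteq> verts (H (\<sigma> i))" using s i by (simp add: \<sigma>_def)
    show "verts (H (\<sigma> i)) \<subseteq> f ` verts (H i)"
    proof
      fix y assume "y \<in> verts (H (\<sigma> i))"
      then obtain i' where "i' \<in> {1..k}" "s i' = s i" "y \<in> f ` verts (H i')"
        using preimage[of "s i" y] s i by (auto simp: \<sigma>_def)
      then show "y \<in> f ` verts (H i)" using bij i by (auto simp: bij_betw_def dest: inj_onD)
    qed
  qed
  ultimately show ?thesis using assms by (auto simp: aut_over_def)
qed

text \<open>The arcs follow the vertices because an arc belongs to the component that contains its tail.\<close>

lemma aut_over_bij_betw_components:
  assumes fg: "(f, g) \<in> aut_over \<sigma>" and \<sigma>: "\<sigma> permutes {1..k}" and i: "i \<in> {1..k}"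
  shows "bij_betw f (verts (H i)) (verts (H (\<sigma> i)))"
    and "bij_betw g (arcs (H i)) (arcs (H (\<sigma> i)))"
proof -
  have f: "f permutes verts G" and g: "g permutes arcs G"
    and ends: "\<And>e. e \<in> arcs G \<Longrightarrow> tail G (g e) = f (tail G e)"
    and img: "\<And>i. i \<in> {1..k} \<Longrightarrow> f ` verts (H i) = verts (H (\<sigma> i))"
    using fg by (auto simp: aut_over_def Aut_def)
  show "bij_betw f (verts (H i)) (verts (H (\<sigma> i)))"
    using img[OF i] permutes_inj[OF f] by (auto simp: bij_betw_def inj_on_def dest: injD)
  have \<sigma>in: "\<sigma> j \<in> {1..k}" if "j \<in> {1..k}" for j
    using that permutes_in_image[OF \<sigma>] by blast
  have into: "g e \<in> arcs (H (\<sigma> j))" if j: "j \<in> {1..k}" and e: "e \<in> arcs (H j)" for j e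
  proof -
    have eG: "e \<in> arcs G" using sub[OF j] e by (auto simp: subgraph_def)
    then have "g e \<in> arcs G" using g by (simp add: permutes_in_image)
    then obtain l where l: "l \<in> {1..k}" "g e \<in> arcs (H l)" by (auto simp: arcs_eq)
    have "tail G (g e) \<in> verts (H (\<sigma> j))"
      using ends[OF eG] ends_in_H(1)[OF j e] img[OF j] by auto
    then have "l = \<sigma> j" using arc_index_unique[OF l(1) \<sigma>in[OF j] l(2)] by simp
    then show ?thesis using l by simp
  qed
  have "arcs (H (\<sigma> i)) \<subseteq> g ` arcs (H i)"
  proof
    fix e' assume e': "e' \<in> arcs (H (\<sigma> i))"
    then have "e' \<in> arcs G" using \<sigma>in[OF i] by (auto simp: arcs_eq)
    then obtain e where e: "e' = g e" "e \<in> arcs G" using permutes_image[OF g] by blast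
    then obtain j where j: "j \<in> {1..k}" "e \<in> arcs (H j)" by (auto simp: arcs_eq)
    then have "\<sigma> j = \<sigma> i"
      using into[OF j] e e' disj_arcs[OF \<sigma>in[OF j(1)] \<sigma>in[OF i]] by blast
    then have "j = i" using permutes_inj[OF \<sigma>] by (auto dest: injD)
    then show "e' \<in> g ` arcs (H i)" using e j by blast
  qed
  then show "bij_betw g (arcs (H i)) (arcs (H (\<sigma> i)))"
    using into[OF i] permutes_inj[OF g] by (auto simp: bij_betw_def inj_on_def dest: injD)
qed

text \<open>An automorphism over \<open>\<sigma>\<close> is the same as a family of isomorphisms from \<open>H i\<close> to \<open>H (\<sigma> i)\<close>, one for
each \<open>i\<close>: restrict it to the components, or glue the family together.\<close>

lemma card_aut_over:
  assumes \<sigma>: "\<sigma> permutes {1..k}"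
  shows "card (aut_over \<sigma>) = (\<Prod>i\<in>{1..k}. card (Iso (H i) (H (\<sigma> i))))"
proof -
  let ?\<Phi> = "\<lambda>(f, g). \<lambda>i\<in>{1..k}. (restrict f (verts (H i)), restrict g (arcs (H i)))"
  have \<sigma>in: "\<sigma> j \<in> {1..k}" if "j \<in> {1..k}" for j
    using that permutes_in_image[OF \<sigma>] by blast
  have "bij_betw ?\<Phi> (aut_over \<sigma>) (PiE {1..k} (\<lambda>i. Iso (H i) (H (\<sigma> i))))"
  proof (rule bij_betw_imageI)
    show "inj_on ?\<Phi> (aut_over \<sigma>)"
    proof (rule inj_onI)
      fix x y assume xy: "x \<in> aut_over \<sigma>" "y \<in> aut_over \<sigma>" "?\<Phi> x = ?\<Phi> y"
      obtain f g f' g' where x: "x = (f, g)" and y: "y = (f', g')" by (metis surj_pair)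
      note fg = xy(1)[unfolded x] and fg' = xy(2)[unfolded y] and eq = xy(3)[unfolded x y prod.case]
      have perm: "f permutes verts G" "g permutes arcs G" "f' permutes verts G" "g' permutes arcs G"
        using fg fg' by (auto simp: aut_over_def Aut_def)
      have eqs: "restrict f (verts (H i)) = restrict f' (verts (H i))"
        "restrict g (arcs (H i)) = restrict g' (arcs (H i))" if "i \<in> {1..k}" for i
        using fun_cong[OF eq, of i] that by auto
      have "f x = f' x" for x
      proof (cases "x \<in> verts G")
        case True
        then obtain i where "i \<in> {1..k}" "x \<in> verts (H i)" by (auto simp: verts_eq)
        then show ?thesis using fun_cong[OF eqs(1), of i x] by simp
      qed (use perm in \<open>simp add: permutes_not_in\<close>)
      moreover have "g e = g' e" for e
      proof (cases "e \<in> arcs G")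
        case True
        then obtain i where "i \<in> {1..k}" "e \<in> arcs (H i)" by (auto simp: arcs_eq)
        then show ?thesis using fun_cong[OF eqs(2), of i e] by simp
      qed (use perm in \<open>simp add: permutes_not_in\<close>)
      ultimately show "x = y" unfolding x y by auto
    qed
    show "?\<Phi> ` aut_over \<sigma> = PiE {1..k} (\<lambda>i. Iso (H i) (H (\<sigma> i)))"
    proof (intro equalityI subsetI)
      fix F assume "F \<in> ?\<Phi> ` aut_over \<sigma>"
      then obtain f g where F: "F = ?\<Phi> (f, g)" and fg: "(f, g) \<in> aut_over \<sigma>" by auto
      have ends: "\<And>e. e \<in> arcs G \<Longrightarrow> tail G (g e) = f (tail G e) \<and> head G (g e) = f (head G e)"
        using fg by (auto simp: aut_over_def Aut_def)
      have "(restrict f (verts (H i)), restrict g (arcs (H i))) \<in> Iso (H i) (H (\<sigma> i))"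
        if i: "i \<in> {1..k}" for i
      proof -
        have "tail G (g e) = f (tail G e) \<and> head G (g e) = f (head G e)" if "e \<in> arcs (H i)" for e
          using ends[of e] that sub[OF i] by (auto simp: subgraph_def)
        then show ?thesis
          using aut_over_bij_betw_components[OF fg \<sigma> i] ends_in_H[OF i] ends_H[OF i] ends_H[OF \<sigma>in[OF i]]
          by (simp add: Iso_def cong: bij_betw_cong)
      qed
      then show "F \<in> PiE {1..k} (\<lambda>i. Iso (H i) (H (\<sigma> i)))" unfolding F by auto
    next
      fix F assume F: "F \<in> PiE {1..k} (\<lambda>i. Iso (H i) (H (\<sigma> i)))"
      define p q where "p i = fst (F i)" and "q i = snd (F i)" for i
      have pq: "(p i, q i) \<in> Iso (H i) (H (\<sigma> i))" if "i \<in> {1..k}" for i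
        using PiE_mem[OF F that] by (simp add: p_def q_def)
      have p: "bij_betw (p i) (verts (H i)) (verts (H (\<sigma> i)))"
        and q: "bij_betw (q i) (arcs (H i)) (arcs (H (\<sigma> i)))" if "i \<in> {1..k}" for i
        using pq[OF that] by (simp_all add: Iso_def)
      have arcs_unique: "i = j"
        if "i \<in> {1..k}" "j \<in> {1..k}" "e \<in> arcs (H i)" "e \<in> arcs (H j)" for i j e
        using arc_index_unique[OF that(1-3)] ends_in_H(1)[OF that(2,4)] by simp
      obtain f where f_perm: "f permutes (\<Union>i\<in>{1..k}. verts (H i))"
        and f_on: "\<forall>i\<in>{1..k}. \<forall>x\<in>verts (H i). f x = p i x"
        by (rule glue_bijections[where I = "{1..k}" and X = "\<lambda>i. verts (H i)", OF index_unique \<sigma> p])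
      obtain g where g_perm: "g permutes (\<Union>i\<in>{1..k}. arcs (H i))"
        and g_on: "\<forall>i\<in>{1..k}. \<forall>e\<in>arcs (H i). g e = q i e"
        by (rule glue_bijections[where I = "{1..k}" and X = "\<lambda>i. arcs (H i)", OF arcs_unique \<sigma> q])
      have f: "f x = p i x" if "i \<in> {1..k}" "x \<in> verts (H i)" for i x
        using f_on that by blast
      have g: "g e = q i e" if "i \<in> {1..k}" "e \<in> arcs (H i)" for i e
        using g_on that by blast
      have "tail G (g e) = f (tail G e) \<and> head G (g e) = f (head G e)" if "e \<in> arcs G" for e
      proof -
        obtain i where i: "i \<in> {1..k}" "e \<in> arcs (H i)" using \<open>e \<in> arcs G\<close> by (auto simp: arcs_eq)
        then show ?thesis
          using pq[OF i(1)] f[OF i(1)] g[OF i] ends_in_H[OF i]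
            ends_H[OF i(1)] ends_H[OF \<sigma>in[OF i(1)]]
          by (auto simp: Iso_def)
      qed
      moreover have "f ` verts (H i) = verts (H (\<sigma> i))" if "i \<in> {1..k}" for i
      proof -
        have "f ` verts (H i) = p i ` verts (H i)" using f[OF that] by (rule image_cong[OF refl])
        then show ?thesis using pq[OF that] by (simp add: Iso_def bij_betw_def)
      qed
      ultimately have "(f, g) \<in> aut_over \<sigma>"
        using f_perm[folded verts_eq] g_perm[folded arcs_eq] by (simp add: aut_over_def Aut_def)
      moreover have "F = ?\<Phi> (f, g)"
      proof
        fix i
        show "F i = ?\<Phi> (f, g) i"
        proof (cases "i \<in> {1..k}")
          case True
          have "restrict f (verts (H i)) = p i" "restrict g (arcs (H i)) = q i"
            using pq[OF True] f[OF True] g[OF True]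
            by (auto simp: Iso_def extensional_def fun_eq_iff)
          then show ?thesis using True by (simp add: p_def q_def)
        qed (use PiE_arb[OF F] in auto)
      qed
      ultimately show "F \<in> ?\<Phi> ` aut_over \<sigma>" by blast
    qed
  qed
  then have "card (aut_over \<sigma>) = card (PiE {1..k} (\<lambda>i. Iso (H i) (H (\<sigma> i))))"
    by (rule bij_betw_same_card)
  then show ?thesis by (simp add: card_PiE)
qed

lemma Sym_iff:
  "\<sigma> \<in> Sym k H \<longleftrightarrow> \<sigma> permutes {1..k} \<and> (\<forall>i\<in>{1..k}. Iso (H i) (H (\<sigma> i)) \<noteq> {})"
proof -
  have "digraph_iso (H (\<sigma> i)) (H i) \<longleftrightarrow> Iso (H i) (H (\<sigma> i)) \<noteq> {}"
    if "\<sigma> permutes {1..k}" "i \<in> {1..k}" for i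
  proof -
    have "\<sigma> i \<in> {1..k}" using that(2) permutes_in_image[OF that(1)] by blast
    then have wf: "wf_digraph (H i)" "wf_digraph (H (\<sigma> i))"
      using fin_H that(2) by (auto simp: fin_digraph_def)
    then show ?thesis
      using Iso_nonempty_iff[OF wf(1), of "H (\<sigma> i)"] digraph_iso_swap[OF wf(1), of "H (\<sigma> i)"]
        digraph_iso_swap[OF wf(2), of "H i"] by metis
  qed
  then show ?thesis by (auto simp: Sym_def)
qed

text \<open>Each \<open>\<sigma>\<close> in \<open>Sym k H\<close> contributes the same number of automorphisms, because a nonempty set of
isomorphisms out of \<open>H i\<close> is as large as the automorphism group of \<open>H i\<close>; any other permutation of the
indices contributes none.\<close>

lemma card_Aut: "card (Aut G) = card (Sym k H) * (\<Prod>i\<in>{1..k}. card (Aut (H i)))"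
proof -
  interpret fin_digraph G by (rule fin)
  have "finite ({f. f permutes verts G} \<times> {g. g permutes arcs G})"
    by (simp add: finite_permutations)
  then have "finite (Aut G)" by (rule rev_finite_subset) (auto simp: Aut_def)
  then have fin_over: "finite (aut_over \<sigma>)" for \<sigma>
    by (rule rev_finite_subset) (auto simp: aut_over_def)
  have fin_Sym: "finite (Sym k H)"
    by (rule finite_subset[OF _ finite_permutations[of "{1..k}"]]) (auto simp: Sym_def)
  have "Aut G = (\<Union>\<sigma>\<in>Sym k H. aut_over \<sigma>)"
  proof
    show "Aut G \<subseteq> (\<Union>\<sigma>\<in>Sym k H. aut_over \<sigma>)"
    proof
      fix x assume "x \<in> Aut G"
      then obtain \<sigma> where \<sigma>: "\<sigma> permutes {1..k}" "x \<in> aut_over \<sigma>"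
        using Aut_permutes_components by (cases x) blast
      then have "card (aut_over \<sigma>) \<noteq> 0" using fin_over by auto
      then have "\<sigma> \<in> Sym k H"
        using \<sigma>(1) unfolding card_aut_over[OF \<sigma>(1)] by (auto simp: Sym_iff)
      with \<sigma> show "x \<in> (\<Union>\<sigma>\<in>Sym k H. aut_over \<sigma>)" by blast
    qed
  qed (auto simp: aut_over_def)
  moreover have "aut_over \<sigma> \<inter> aut_over \<tau> = {}"
    if \<sigma>: "\<sigma> \<in> Sym k H" and \<tau>: "\<tau> \<in> Sym k H" and "\<sigma> \<noteq> \<tau>" for \<sigma> \<tau>
  proof (rule ccontr)
    have perm: "\<sigma> permutes {1..k}" "\<tau> permutes {1..k}" using \<sigma> \<tau> by (auto simp: Sym_def)
    assume "aut_over \<sigma> \<inter> aut_over \<tau> \<noteq> {}"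
    then obtain f g where "(f, g) \<in> aut_over \<sigma>" "(f, g) \<in> aut_over \<tau>" by auto
    then have f: "\<And>i. i \<in> {1..k} \<Longrightarrow> f ` verts (H i) = verts (H (\<sigma> i))"
      "\<And>i. i \<in> {1..k} \<Longrightarrow> f ` verts (H i) = verts (H (\<tau> i))"
      by (auto simp: aut_over_def)
    \<comment> \<open>The components are nonempty and disjoint, so their images determine the permutation.\<close>
    have "\<sigma> i = \<tau> i" for i
    proof (cases "i \<in> {1..k}")
      case True
      then obtain x where "x \<in> verts (H i)" using H_nonempty by blast
      then have "f x \<in> verts (H (\<sigma> i))" "f x \<in> verts (H (\<tau> i))" using f[OF True] by blast+
      moreover have "\<sigma> i \<in> {1..k}" "\<tau> i \<in> {1..k}"
        using True permutes_in_image[OF perm(1)] permutes_in_image[OF perm(2)] by blast+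
      ultimately show ?thesis by (intro index_unique)
    qed (use perm in \<open>simp add: permutes_not_in\<close>)
    then show False using \<open>\<sigma> \<noteq> \<tau>\<close> by auto
  qed
  ultimately have "card (Aut G) = (\<Sum>\<sigma>\<in>Sym k H. card (aut_over \<sigma>))"
    using fin_Sym fin_over by (simp add: card_UN_disjoint)
  also have "\<dots> = (\<Sum>\<sigma>\<in>Sym k H. \<Prod>i\<in>{1..k}. card (Aut (H i)))"
  proof (rule sum.cong[OF refl])
    fix \<sigma> assume "\<sigma> \<in> Sym k H"
    then have \<sigma>: "\<sigma> permutes {1..k}" "\<forall>i\<in>{1..k}. Iso (H i) (H (\<sigma> i)) \<noteq> {}" by (auto simp: Sym_iff)
    have "card (Iso (H i) (H (\<sigma> i))) = card (Aut (H i))" if "i \<in> {1..k}" for i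
      using \<sigma>(2) that fin_H[OF that] by (intro card_Iso) (auto simp: fin_digraph_def)
    then show "card (aut_over \<sigma>) = (\<Prod>i\<in>{1..k}. card (Aut (H i)))"
      unfolding card_aut_over[OF \<sigma>(1)] by (intro prod.cong) auto
  qed
  finally show ?thesis by simp
qed

lemma card_verts_sum: "card (verts G) = (\<Sum>i\<in>{1..k}. card (verts (H i)))"
  unfolding verts_eq using fin_H disj
  by (intro card_UN_disjoint) (auto simp: fin_digraph_def fin_digraph_axioms_def)

lemma weight_sum: "weight G = (\<Sum>i\<in>{1..k}. weight (H i))"
proof -
  have "card (arcs G) = (\<Sum>i\<in>{1..k}. card (arcs (H i)))"
    unfolding arcs_eq using fin_H disj_arcs
    by (intro card_UN_disjoint) (auto simp: fin_digraph_def fin_digraph_axioms_def)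
  then show ?thesis by (simp add: weight_def card_verts_sum sum_subtractf)
qed

lemma z_eq_prod: "z G = (\<Prod>j\<in>{1..k}. z (H j)) / real (card (Sym k H))"
proof -
  have "(2::real) powi weight G = (\<Prod>j\<in>{1..k}. 2 powi weight (H j))"
    unfolding weight_sum by (induction k) (simp_all add: power_int_add)
  moreover have "(\<Prod>j\<in>{1..k}. z (H j)) = (\<Prod>j\<in>{1..k}. (-1) ^ card (verts (H j)) *
      2 powi weight (H j) / real (card (Aut (H j))) * cut_sum (H j))"
    using fin_H z_eq_cut_sum by (intro prod.cong) auto
  ultimately show ?thesis
    unfolding z_eq_cut_sum[OF fin] card_Aut card_verts_sum cut_sum_prod
    by (simp add: prod.distrib prod_dividef power_sum divide_simps mult_ac)
qed

end

theorem proposition2p22: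
  fixes G :: "('a, 'b) pre_digraph"
    and H :: "nat \<Rightarrow> ('a, 'b) pre_digraph"
    and k :: nat
  assumes "fin_digraph G"
    and "stable G"
    and "\<And>i. i \<in> {1..k} \<Longrightarrow> subgraph (H i) G"
    and "\<And>i. i \<in> {1..k} \<Longrightarrow> Digraph_Component.connected (H i)"
    and "\<And>i j. i \<in> {1..k} \<Longrightarrow> j \<in> {1..k} \<Longrightarrow> i \<noteq> j \<Longrightarrow> verts (H i) \<inter> verts (H j) = {}"
    and "verts G = (\<Union>i\<in>{1..k}. verts (H i))"
    and "arcs G = (\<Union>i\<in>{1..k}. arcs (H i))"
  shows "z G = (\<Prod>j\<in>{1..k}. z (H j)) / real (card (Sym k H))"
proof -
  interpret disjoint_components G H k
    by (rule disjoint_components.intro) (fact assms)+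
  show ?thesis by (rule z_eq_prod)
qed

end
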